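(* For all $a>-1$ and $b>-1$, the Beta distribution $\beta(a,b)$ on $[-1,1]$, whose density with respect to Lebesgue measure is proportional to $(1-x)^a(1+x)^b$, belongs to $\mathscr{L}$.
   Context: Wiener space: the product $\bigotimes_{k\in\mathbb{N}} (\mathbb{R}, \mathfrak{B}(\mathbb{R}), \gamma)$ with $\gamma$ the standard Gaussian measure; its coordinates $(Y_k)$ are i.i.d. standard Gaussian. For smooth cylindrical $F,R$, $\Gamma(F,R) = \sum_k (\partial_{y_k}F)(\partial_{y_k}R)$ (carré du champ), extended by closure. $\mathsf{L}$ is the associated self-adjoint (Ornstein--Uhlenbeck) generator, characterized by $\mathbf{E}[\Gamma(F,R)] = -\mathbf{E}[F\,\mathsf{L}R]$. $\mathbb{D}^\infty = \{F : \mathsf{L}^k F \in \mathrm{Dom}(\mathsf{L}) \cap \bigcap_{1<p<\infty} L^p \text{ for all } k\geq 0\}$. $\mathscr{L}$ is the set of laws $\mu$ on $\mathbb{R}$ that can be realized as the law of some $X\in\mathbb{D}^\infty$ for which there is $\theta>0$ with $\mathbf{E}[\Gamma(X,X)^{-\theta}]<\infty$. *)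

theory Defs
  imports "HOL-Probability.Probability"
begin

text \<open>
  Random variables on Wiener space are represented by functions \<open>(nat \<Rightarrow> real) \<Rightarrow> real\<close>, the
  coordinate \<open>Y\<^sub>k\<close> being \<open>\<lambda>y. y k\<close>.  Since they matter only up to almost sure equality,
  \<open>\<Gamma>\<close> and \<open>L\<close> are given as relations: \<open>carre_du_champ F R G\<close> says that \<open>G\<close> is a version of
  \<open>\<Gamma>(F,R)\<close>, and \<open>OU_generator R H\<close> that \<open>R \<in> Dom L\<close> and \<open>H\<close> is a version of \<open>L R\<close>.
\<close>

definition wiener :: "(nat \<Rightarrow> real) measure" where
  "wiener = (\<Pi>\<^sub>M k\<in>(UNIV :: nat set). density lborel (\<lambda>x. ennreal (std_normal_density x)))"

definition Lp :: "real \<Rightarrow> ((nat \<Rightarrow> real) \<Rightarrow> real) set" where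
  "Lp p = {F \<in> borel_measurable wiener. integrable wiener (\<lambda>y. \<bar>F y\<bar> powr p)}"

definition tendsto_Lp ::
  "real \<Rightarrow> (nat \<Rightarrow> (nat \<Rightarrow> real) \<Rightarrow> real) \<Rightarrow> ((nat \<Rightarrow> real) \<Rightarrow> real) \<Rightarrow> bool" where
  "tendsto_Lp p Fs F \<longleftrightarrow> (\<forall>n. Fs n \<in> Lp p) \<and> F \<in> Lp p \<and>
     (\<lambda>n. \<integral>y. \<bar>Fs n y - F y\<bar> powr p \<partial>wiener) \<longlonglongrightarrow> 0"


subsection \<open>Smooth cylindrical functionals\<close>

definition partial :: "nat \<Rightarrow> ((nat \<Rightarrow> real) \<Rightarrow> real) \<Rightarrow> (nat \<Rightarrow> real) \<Rightarrow> real" where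
  "partial k F y = deriv (\<lambda>t. F (y(k := t))) (y k)"

primrec iter_partial :: "nat list \<Rightarrow> ((nat \<Rightarrow> real) \<Rightarrow> real) \<Rightarrow> (nat \<Rightarrow> real) \<Rightarrow> real" where
  "iter_partial [] F = F"
| "iter_partial (k # ks) F = partial k (iter_partial ks F)"

text \<open>
  \<open>F = f(Y\<^sub>0, \<dots>, Y\<^sub>n\<^sub>-\<^sub>1)\<close> with \<open>f\<close> of class \<open>C\<^sup>\<infinity>\<close> and all its partial derivatives of polynomial
  growth.  Continuity is that of the product topology on \<open>nat \<Rightarrow> real\<close>; as \<open>F\<close> depends on the first
  \<open>n\<close> coordinates only, it is continuity of \<open>f\<close> on \<open>\<real>\<^sup>n\<close>.
\<close>

definition smooth_cylindrical :: "((nat \<Rightarrow> real) \<Rightarrow> real) set" where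
  "smooth_cylindrical = {F. \<exists>n.
     (\<forall>y z. (\<forall>i<n. y i = z i) \<longrightarrow> F y = F z) \<and>
     (\<forall>ks. continuous_on UNIV (iter_partial ks F) \<and>
           (\<forall>k y. (\<lambda>t. iter_partial ks F (y(k := t))) differentiable (at (y k))) \<and>
           (\<exists>C m. \<forall>y. \<bar>iter_partial ks F y\<bar> \<le> C * (1 + (\<Sum>i<n. (y i)\<^sup>2)) ^ m))}"


subsection \<open>Carre du champ and its closure\<close>

text \<open>For cylindrical \<open>F\<close> and \<open>R\<close> only finitely many terms of the series are nonzero.\<close>

definition cyl_Gamma ::
  "((nat \<Rightarrow> real) \<Rightarrow> real) \<Rightarrow> ((nat \<Rightarrow> real) \<Rightarrow> real) \<Rightarrow> (nat \<Rightarrow> real) \<Rightarrow> real" where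
  "cyl_Gamma F R y = (\<Sum>k. partial k F y * partial k R y)"

text \<open>
  Convergence in \<open>L\<^sup>2\<close> together with the Cauchy property for the energy \<open>E[\<Gamma>(F,F)]\<close>: the limits
  reached in this way form the domain of the closed Dirichlet form.
\<close>

definition form_approx ::
  "(nat \<Rightarrow> (nat \<Rightarrow> real) \<Rightarrow> real) \<Rightarrow> ((nat \<Rightarrow> real) \<Rightarrow> real) \<Rightarrow> bool" where
  "form_approx Fs F \<longleftrightarrow> (\<forall>n. Fs n \<in> smooth_cylindrical) \<and> tendsto_Lp 2 Fs F \<and>
     (\<forall>e>0. \<exists>N. \<forall>m\<ge>N. \<forall>n\<ge>N.
        (\<integral>y. cyl_Gamma (\<lambda>z. Fs m z - Fs n z) (\<lambda>z. Fs m z - Fs n z) y \<partial>wiener) < e)"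

definition form_domain :: "((nat \<Rightarrow> real) \<Rightarrow> real) set" where
  "form_domain = {F. \<exists>Fs. form_approx Fs F}"

definition carre_du_champ ::
  "((nat \<Rightarrow> real) \<Rightarrow> real) \<Rightarrow> ((nat \<Rightarrow> real) \<Rightarrow> real) \<Rightarrow> ((nat \<Rightarrow> real) \<Rightarrow> real) \<Rightarrow> bool" where
  "carre_du_champ F R G \<longleftrightarrow> (\<exists>Fs Rs. form_approx Fs F \<and> form_approx Rs R \<and>
     tendsto_Lp 1 (\<lambda>n. cyl_Gamma (Fs n) (Rs n)) G)"


subsection \<open>Ornstein--Uhlenbeck generator\<close>

definition OU_generator :: "((nat \<Rightarrow> real) \<Rightarrow> real) \<Rightarrow> ((nat \<Rightarrow> real) \<Rightarrow> real) \<Rightarrow> bool" where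
  "OU_generator R H \<longleftrightarrow> R \<in> form_domain \<and> H \<in> Lp 2 \<and>
     (\<forall>F\<in>form_domain. \<forall>G. carre_du_champ F R G \<longrightarrow>
        (\<integral>y. G y \<partial>wiener) = - (\<integral>y. F y * H y \<partial>wiener))"

text \<open>The sequence \<open>H\<close> consists of versions of the iterates: \<open>H k = L\<^sup>k F\<close>.\<close>

definition D_infty :: "((nat \<Rightarrow> real) \<Rightarrow> real) set" where
  "D_infty = {F. \<exists>H. H 0 = F \<and>
     (\<forall>k::nat. OU_generator (H k) (H (Suc k)) \<and> (\<forall>p>1. H k \<in> Lp p))}"


subsection \<open>The class of laws\<close>

text \<open>
  \<open>E[G\<^sup>-\<^sup>\<theta>]\<close> with the convention \<open>0\<^sup>-\<^sup>\<theta> = \<infinity>\<close> (whereas \<open>0 powr (-\<theta>) = 0\<close>).  Versions of \<open>\<Gamma>(X,X)\<close>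
  are nonnegative almost surely, so the value chosen on \<open>{G < 0}\<close> is immaterial.
\<close>

definition neg_moment :: "real \<Rightarrow> ((nat \<Rightarrow> real) \<Rightarrow> real) \<Rightarrow> ennreal" where
  "neg_moment \<theta> G = (\<integral>\<^sup>+y. (if G y > 0 then ennreal (G y powr (-\<theta>)) else \<infinity>) \<partial>wiener)"

definition law_class :: "real measure set" where
  "law_class = {distr wiener borel X | X.
     X \<in> D_infty \<and> (\<exists>\<theta>>0. \<exists>G. carre_du_champ X X G \<and> neg_moment \<theta> G < \<infinity>)}"


subsection \<open>Beta distributions on \<open>[-1,1]\<close>\<close>

definition beta_weight :: "real \<Rightarrow> real \<Rightarrow> real \<Rightarrow> real" where
  "beta_weight a b x = indicator {-1..1} x * (1 - x) powr a * (1 + x) powr b"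

definition beta_law :: "real \<Rightarrow> real \<Rightarrow> real measure" where
  "beta_law a b =
     density lborel (\<lambda>x. ennreal (beta_weight a b x / (\<integral>u. beta_weight a b u \<partial>lborel)))"

end

theory Submission
  imports Defs
begin

text \<open>
  A function of the single coordinate \<open>Y\<^sub>0\<close> suffices: let \<open>X\<close> be the monotone transport of the standard
  Gaussian to the Beta law, so that \<open>X' = \<gamma> / \<rho>(X)\<close> with \<open>\<gamma>\<close>, \<open>\<rho>\<close> the two densities.  The function
  \<open>P = X' / (1 - X\<^sup>2)\<close> grows at most linearly, by comparing the tails of the two laws, and \<open>t, X, P\<close>
  satisfy a polynomial differential system; hence they generate an algebra of functions of polynomial
  growth that is stable under \<open>f \<mapsto> f'' - t f'\<close>, and \<open>X(Y\<^sub>0)\<close> lies in \<open>\<D>\<^sup>\<infinity>\<close>.  Finally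
  \<open>\<Gamma>(X,X) = X'(Y\<^sub>0)\<^sup>2\<close>, whose small negative moments are controlled by \<open>\<integral>\<rho>\<^bsup>1+s\<^esup>\<close> and \<open>\<integral>\<gamma>\<^bsup>1-s\<^esup>\<close>.
\<close>

subsection \<open>Wiener space\<close>

text \<open>The analytic obstacle is the boundary: differentiating
  \<open>X' = \<gamma> / \<rho>(X)\<close> produces \<rho>'/\<rho>, which has poles at -1 and 1, and
  \<open>X\<close> approaches both. Dividing by 1 - X^2 cancels them: the logarithmic derivative of
  \<open>P\<close> is -t + (a+1) X'/(1-X) - (b+1) X'/(1+X), and both quotients become polynomials in
  \<open>X\<close> and \<open>P\<close>. The growth of \<open>P\<close> rests on two estimates: near
  1 the Beta law gives [x,1] a mass of at most a constant times (1-x)^(a+1), while the Gaussian law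
  gives an interval of length 1/(1+y) starting at y a mass of at least a constant times
  \<gamma>(y)/(1+y). The transport equates such masses. The other obstacle lies in the closure:
  \<open>OU_generator\<close> tests against every version of \<Gamma>(F,R), obtained from arbitrary
  approximations of F and also of R. Even for a cylindrical R, where the formula for L R is
  explicit, the approximations of R must therefore be shown to converge in energy. That is
  closability, and it follows from Gaussian integration by parts.\<close>

abbreviation gauss :: "real measure" where
  "gauss \<equiv> density lborel (\<lambda>x. ennreal (std_normal_density x))"

lemma prob_space_gauss: "prob_space gauss"
  using prob_space_normal_density[of 1 0] by simp

lemma sets_wiener: "sets wiener = sets borel"
proof -
  have "sets wiener = sets (Pi\<^sub>M UNIV (\<lambda>i::nat. borel :: real measure))"
    unfolding wiener_def by (rule sets_PiM_cong) auto
  then show ?thesis using sets_PiM_equal_borel by simp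
qed

lemma space_wiener [simp]: "space wiener = UNIV"
  by (simp add: wiener_def space_PiM)

lemma prob_space_wiener: "prob_space wiener"
  unfolding wiener_def by (rule prob_space_PiM) (rule prob_space_gauss)

interpretation gauss: prob_space gauss by (rule prob_space_gauss)
interpretation wiener: prob_space wiener by (rule prob_space_wiener)
interpretation gauss_wiener: pair_sigma_finite gauss wiener ..

lemma borel_measurable_wiener: "borel_measurable wiener = borel_measurable borel"
  by (rule measurable_cong_sets) (auto simp: sets_wiener)

lemma continuous_measurable_wiener:
  "continuous_on UNIV F \<Longrightarrow> F \<in> borel_measurable wiener"
  by (simp add: borel_measurable_wiener borel_measurable_continuous_onI)

lemma coordinate_measurable [measurable]: "(\<lambda>y. y k) \<in> borel_measurable wiener"
proof -
  have "(\<lambda>y. y k) \<in> wiener \<rightarrow>\<^sub>M gauss"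
    unfolding wiener_def by (rule measurable_component_singleton) auto
  then show ?thesis by simp
qed

lemma distr_coordinate: "distr wiener borel (\<lambda>y. y k) = gauss"
proof -
  have "distr wiener gauss (\<lambda>y. y k) = gauss"
    unfolding wiener_def by (rule distr_PiM_component) (auto intro: prob_space_gauss)
  moreover have "distr wiener gauss (\<lambda>y. y k) = distr wiener borel (\<lambda>y. y k)"
    by (rule distr_cong) auto
  ultimately show ?thesis by simp
qed

lemma resample_measurable: "(\<lambda>(t, y). y(k := t)) \<in> gauss \<Otimes>\<^sub>M wiener \<rightarrow>\<^sub>M wiener"
proof -
  have "(\<lambda>p. (snd p)(k := fst p)) \<in> gauss \<Otimes>\<^sub>M wiener \<rightarrow>\<^sub>M wiener"
    unfolding wiener_def
  proof (rule measurable_fun_upd[where J = UNIV])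
    show "(UNIV::nat set) = UNIV \<union> {k}" by simp
    show "snd \<in> gauss \<Otimes>\<^sub>M Pi\<^sub>M UNIV (\<lambda>k. gauss) \<rightarrow>\<^sub>M Pi\<^sub>M UNIV (\<lambda>k. gauss)" by (rule measurable_snd)
    show "fst \<in> gauss \<Otimes>\<^sub>M Pi\<^sub>M UNIV (\<lambda>k. gauss) \<rightarrow>\<^sub>M gauss" by (rule measurable_fst)
  qed
  then show ?thesis by (simp add: case_prod_unfold)
qed

lemma distr_resample: "distr (gauss \<Otimes>\<^sub>M wiener) wiener (\<lambda>(t, y). y(k := t)) = wiener"
  using distr_pair_PiM_eq_PiM[of "UNIV :: nat set" "\<lambda>_. gauss" k] prob_space_gauss
  by (simp add: wiener_def)

text \<open>The product measure is invariant under replacing coordinate \<open>k\<close> by an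
  independent Gaussian, and Fubini does the rest. It reduces identities on Wiener space to
  one-dimensional Gaussian identities along the lines \<open>t \<mapsto> y(k := t)\<close>.\<close>

lemma integral_resample:
  fixes G :: "(nat \<Rightarrow> real) \<Rightarrow> real"
  assumes G: "integrable wiener G"
  shows "(\<integral>y. G y \<partial>wiener) = (\<integral>y. (\<integral>t. G (y(k := t)) \<partial>gauss) \<partial>wiener)"
proof -
  let ?T = "\<lambda>(t, y). (y::nat \<Rightarrow> real)(k := t)"
  have Gm: "G \<in> borel_measurable wiener" using G by simp
  have "integrable (distr (gauss \<Otimes>\<^sub>M wiener) wiener ?T) G" using G by (simp add: distr_resample)
  then have i: "integrable (gauss \<Otimes>\<^sub>M wiener) (\<lambda>x. G (?T x))"
    by (subst (asm) integrable_distr_eq[OF resample_measurable Gm])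
  have "(\<integral>y. G y \<partial>wiener) = (\<integral>y. G y \<partial>distr (gauss \<Otimes>\<^sub>M wiener) wiener ?T)"
    by (simp add: distr_resample)
  also have "\<dots> = (\<integral>x. G (?T x) \<partial>(gauss \<Otimes>\<^sub>M wiener))"
    by (rule integral_distr[OF resample_measurable Gm])
  also have "\<dots> = (\<integral>y. (\<integral>t. G (y(k := t)) \<partial>gauss) \<partial>wiener)"
    using gauss_wiener.integral_snd[of "\<lambda>t y. G (y(k := t))"] i
    by (simp add: case_prod_unfold)
  finally show ?thesis .
qed

subsection \<open>Polynomial growth and Gaussian moments\<close>

lemma abs_le_1_plus_square: "\<bar>t :: real\<bar> \<le> 1 + t\<^sup>2"
  using sum_squares_bound[of "\<bar>t\<bar>" 1] by simp

text \<open>The extra power t^j is there for the induction: expanding one factor 1 + t^2 trades it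
  for the exponents j and j + 2.\<close>

lemma integrable_std_normal_poly:
  "integrable lborel (\<lambda>t. std_normal_density t * (t ^ j * (1 + t\<^sup>2) ^ m))"
proof (induction m arbitrary: j)
  case 0
  then show ?case using integrable_std_normal_moment[of j] by simp
next
  case (Suc m)
  have "(\<lambda>t::real. std_normal_density t * (t ^ j * (1 + t\<^sup>2) ^ Suc m)) =
    (\<lambda>t. std_normal_density t * (t ^ j * (1 + t\<^sup>2) ^ m) +
         std_normal_density t * (t ^ (j + 2) * (1 + t\<^sup>2) ^ m))"
    by (intro ext) (simp add: algebra_simps power_add power2_eq_square)
  then show ?case using Suc[of j] Suc[of "j + 2"] by (simp only: Bochner_Integration.integrable_add)
qed

lemma integrable_gauss_poly: "integrable gauss (\<lambda>t. (1 + t\<^sup>2) ^ m)"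
  using integrable_std_normal_poly[of 0 m] by (subst integrable_density) auto

lemma integrable_gauss_growth:
  fixes f :: "real \<Rightarrow> real"
  assumes "f \<in> borel_measurable borel" "\<And>t. \<bar>f t\<bar> \<le> C * (1 + t\<^sup>2) ^ m"
  shows "integrable gauss f"
proof (rule Bochner_Integration.integrable_bound)
  show "integrable gauss (\<lambda>t. C * (1 + t\<^sup>2) ^ m)"
    using integrable_gauss_poly by simp
  show "AE x in gauss. norm (f x) \<le> norm (C * (1 + x\<^sup>2) ^ m)"
    using assms(2) by (intro AE_I2) (metis abs_ge_self order_trans real_norm_def)
qed (use assms in simp)

text \<open>With s = (1 + t^2)/2 this is s^m / exp s tending to 0. The filter is arbitrary so that
  both ends of the line are covered at once.\<close>

lemma tendsto_gaussian_poly: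
  assumes "filterlim (\<lambda>t::real. t\<^sup>2) at_top L"
  shows "((\<lambda>t. std_normal_density t * (1 + t\<^sup>2) ^ m) \<longlongrightarrow> 0) L"
proof -
  have l: "filterlim (\<lambda>t::real. (1/2) * (1 + t\<^sup>2)) at_top L"
    by (rule filterlim_tendsto_pos_mult_at_top[OF tendsto_const])
       (auto intro: filterlim_tendsto_add_at_top[OF tendsto_const assms])
  have "((\<lambda>t::real. ((1/2) * (1 + t\<^sup>2)) ^ m / exp ((1/2) * (1 + t\<^sup>2))) \<longlongrightarrow> 0) L"
    by (rule filterlim_compose[OF tendsto_power_div_exp_0 l])
  then have "((\<lambda>t::real. (2 ^ m * exp (1/2) / sqrt (2 * pi)) *
      (((1/2) * (1 + t\<^sup>2)) ^ m / exp ((1/2) * (1 + t\<^sup>2)))) \<longlongrightarrow> (2 ^ m * exp (1/2) / sqrt (2 * pi)) * 0) L"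
    by (intro tendsto_mult tendsto_const)
  moreover have "(2 ^ m * exp (1/2) / sqrt (2 * pi)) *
      (((1/2) * (1 + t\<^sup>2)) ^ m / exp ((1/2) * (1 + t\<^sup>2))) = std_normal_density t * (1 + t\<^sup>2) ^ m" for t :: real
  proof -
    have "exp ((1/2) * (1 + t\<^sup>2)) = exp (1/2) * exp (t\<^sup>2 / 2)"
      by (simp add: distrib_left exp_add)
    then show ?thesis
      by (simp add: std_normal_density_def power_mult_distrib power_divide exp_minus field_simps)
  qed
  ultimately show ?thesis by simp
qed

lemma std_normal_density_DERIV:
  "(std_normal_density has_real_derivative - t * std_normal_density t) (at t)"
  unfolding std_normal_density_def by (auto intro!: derivative_eq_intros simp: field_simps)

text \<open>\<gamma> (h' - t h) is the derivative of \<gamma> h. Polynomial growth makes it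
  integrable and the boundary terms at both infinities zero.\<close>

lemma gauss_stein:
  fixes h h' :: "real \<Rightarrow> real"
  assumes d: "\<And>t. (h has_real_derivative h' t) (at t)" and c: "continuous_on UNIV h'"
    and h: "\<And>t. \<bar>h t\<bar> \<le> C * (1 + t\<^sup>2) ^ m" and h': "\<And>t. \<bar>h' t\<bar> \<le> D * (1 + t\<^sup>2) ^ l"
  shows "(\<integral>t. h' t - t * h t \<partial>gauss) = 0"
proof -
  have ch: "continuous_on UNIV h"
    by (rule DERIV_continuous_on, rule has_field_derivative_at_within, rule d)
  let ?F = "\<lambda>t. std_normal_density t * h t" and ?f = "\<lambda>t. std_normal_density t * (h' t - t * h t)"
  have cn: "continuous_on UNIV std_normal_density"
    by (rule DERIV_continuous_on, rule has_field_derivative_at_within, rule std_normal_density_DERIV)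
  have C: "C \<ge> 0" using h[of 0] by simp
  have D: "D \<ge> 0" using h'[of 0] by simp
  have bd: "\<bar>h' t - t * h t\<bar> \<le> (D + C) * (1 + t\<^sup>2) ^ (l + m + 1)" for t
  proof -
    have g1: "1 + t\<^sup>2 \<ge> 1" by simp
    have t: "\<bar>t\<bar> \<le> 1 + t\<^sup>2" by (rule abs_le_1_plus_square)
    have "\<bar>h' t - t * h t\<bar> \<le> \<bar>h' t\<bar> + \<bar>t\<bar> * \<bar>h t\<bar>" by (metis abs_mult abs_triangle_ineq4)
    also have "\<dots> \<le> D * (1 + t\<^sup>2) ^ l + (1 + t\<^sup>2) * (C * (1 + t\<^sup>2) ^ m)"
      using h'[of t] h[of t] t by (intro add_mono mult_mono) auto
    also have "\<dots> = D * (1 + t\<^sup>2) ^ l + C * (1 + t\<^sup>2) ^ (m + 1)" by simp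
    also have "\<dots> \<le> D * (1 + t\<^sup>2) ^ (l + m + 1) + C * (1 + t\<^sup>2) ^ (l + m + 1)"
      using C D g1 by (intro add_mono mult_left_mono power_increasing) auto
    finally show ?thesis by (simp add: algebra_simps)
  qed
  have cf: "continuous_on UNIV (\<lambda>t. h' t - t * h t)" using c ch by (intro continuous_intros)
  have "integrable gauss (\<lambda>t. h' t - t * h t)"
    by (rule integrable_gauss_growth[OF _ bd]) (use cf in \<open>simp add: borel_measurable_continuous_onI\<close>)
  then have int: "integrable lborel ?f"
    by (subst (asm) integrable_density) (use cf in \<open>auto simp: borel_measurable_continuous_onI\<close>)
  have lim: "(?F \<longlongrightarrow> 0) L" if "filterlim (\<lambda>t::real. t\<^sup>2) at_top L" for L
  proof (rule Lim_null_comparison)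
    show "\<forall>\<^sub>F x in L. norm (?F x) \<le> C * (std_normal_density x * (1 + x\<^sup>2) ^ m)"
      using mult_left_mono[OF h normal_density_nonneg[of 0 1]]
      by (intro always_eventually allI) (simp add: abs_mult mult.left_commute)
    show "((\<lambda>x. C * (std_normal_density x * (1 + x\<^sup>2) ^ m)) \<longlongrightarrow> 0) L"
      using tendsto_mult[OF tendsto_const[of C] tendsto_gaussian_poly[OF that]] by simp
  qed
  have "(LBINT x=-\<infinity>..\<infinity>. ?f x) = 0 - 0"
  proof (rule interval_integral_FTC_integrable[where F = ?F])
    show "(?F has_vector_derivative ?f x) (at x)" for x
    proof -
      have "(?F has_real_derivative ?f x) (at x)"
        by (rule derivative_eq_intros std_normal_density_DERIV d refl | simp add: algebra_simps)+
      then show ?thesis by (simp add: has_real_derivative_iff_has_vector_derivative)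
    qed
    show "isCont ?f x" for x
    proof -
      have "continuous_on UNIV ?f" using cn c ch by (intro continuous_intros)
      then show ?thesis by (simp add: continuous_on_eq_continuous_at)
    qed
    show "set_integrable lborel (einterval (-\<infinity>) \<infinity>) ?f" using int by (simp add: set_integrable_def)
    have "filterlim (\<lambda>t::real. t\<^sup>2) at_top at_bot" "filterlim (\<lambda>t::real. t\<^sup>2) at_top at_top"
      by (auto intro: filterlim_pow_at_bot_even filterlim_pow_at_top filterlim_ident)
    then show "((?F \<circ> real_of_ereal) \<longlongrightarrow> 0) (at_right (-\<infinity>))"
      "((?F \<circ> real_of_ereal) \<longlongrightarrow> 0) (at_left \<infinity>)"
      by (simp_all add: ereal_tendsto_simps1 lim)
  qed auto
  then show ?thesis
    by (subst integral_density) 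
      (use cf in \<open>auto simp: borel_measurable_continuous_onI interval_lebesgue_integral_def
        set_lebesgue_integral_def\<close>)
qed

lemma cylinder_growth_nonneg:
  fixes F :: "(nat \<Rightarrow> real) \<Rightarrow> real"
  assumes "\<And>y. \<bar>F y\<bar> \<le> C * (1 + (\<Sum>i<n. (y i)\<^sup>2)) ^ m"
  shows "C \<ge> 0"
  using assms[of "\<lambda>_. 0"] by simp

text \<open>The bound of \<open>smooth_cylindrical\<close> with its constants hidden, so that it can
  be propagated through sums and products.\<close>

definition poly_growth :: "nat \<Rightarrow> ((nat \<Rightarrow> real) \<Rightarrow> real) \<Rightarrow> bool" where
  "poly_growth n F \<longleftrightarrow> (\<exists>C m. \<forall>y. \<bar>F y\<bar> \<le> C * (1 + (\<Sum>i<n. (y i)\<^sup>2)) ^ m)"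

lemma poly_growthE:
  assumes "poly_growth n F"
  obtains C m where "C \<ge> 0" "\<And>y. \<bar>F y\<bar> \<le> C * (1 + (\<Sum>i<n. (y i)\<^sup>2)) ^ m"
  using assms unfolding poly_growth_def by (metis cylinder_growth_nonneg)

lemma poly_growth_mono:
  assumes "poly_growth n F" "n \<le> n'"
  shows "poly_growth n' F"
proof -
  obtain C m where C: "C \<ge> 0" "\<And>y. \<bar>F y\<bar> \<le> C * (1 + (\<Sum>i<n. (y i)\<^sup>2)) ^ m"
    using assms(1) by (rule poly_growthE) blast
  have "C * (1 + (\<Sum>i<n. (y i)\<^sup>2)) ^ m \<le> C * (1 + (\<Sum>i<n'. (y i)\<^sup>2)) ^ m" for y
    using C(1) assms(2) by (intro mult_left_mono power_mono add_left_mono sum_mono2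
        add_nonneg_nonneg sum_nonneg) auto
  then show ?thesis using C(2) unfolding poly_growth_def by (meson order_trans)
qed

lemma poly_growth_add:
  assumes "poly_growth n F" "poly_growth n G"
  shows "poly_growth n (\<lambda>y. F y + G y)"
proof -
  obtain C m where C: "C \<ge> 0" "\<And>y. \<bar>F y\<bar> \<le> C * (1 + (\<Sum>i<n. (y i)\<^sup>2)) ^ m"
    using assms(1) by (rule poly_growthE) blast
  obtain D l where D: "D \<ge> 0" "\<And>y. \<bar>G y\<bar> \<le> D * (1 + (\<Sum>i<n. (y i)\<^sup>2)) ^ l"
    using assms(2) by (rule poly_growthE) blast
  have "\<bar>F y + G y\<bar> \<le> (C + D) * (1 + (\<Sum>i<n. (y i)\<^sup>2)) ^ (m + l)" for y
  proof -
    have g: "1 \<le> 1 + (\<Sum>i<n. (y i)\<^sup>2)" by (simp add: sum_nonneg)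
    have "\<bar>F y + G y\<bar> \<le> C * (1 + (\<Sum>i<n. (y i)\<^sup>2)) ^ m + D * (1 + (\<Sum>i<n. (y i)\<^sup>2)) ^ l"
      using C(2)[of y] D(2)[of y] by linarith
    also have "\<dots> \<le> C * (1 + (\<Sum>i<n. (y i)\<^sup>2)) ^ (m + l) + D * (1 + (\<Sum>i<n. (y i)\<^sup>2)) ^ (m + l)"
      using C(1) D(1) g by (intro add_mono mult_left_mono power_increasing) auto
    finally show ?thesis by (simp add: algebra_simps)
  qed
  then show ?thesis unfolding poly_growth_def by blast
qed

lemma poly_growth_mult:
  assumes "poly_growth n F" "poly_growth n G"
  shows "poly_growth n (\<lambda>y. F y * G y)"
proof -
  obtain C m where C: "C \<ge> 0" "\<And>y. \<bar>F y\<bar> \<le> C * (1 + (\<Sum>i<n. (y i)\<^sup>2)) ^ m"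
    using assms(1) by (rule poly_growthE) blast
  obtain D l where D: "D \<ge> 0" "\<And>y. \<bar>G y\<bar> \<le> D * (1 + (\<Sum>i<n. (y i)\<^sup>2)) ^ l"
    using assms(2) by (rule poly_growthE) blast
  have "\<bar>F y * G y\<bar> \<le> (C * D) * (1 + (\<Sum>i<n. (y i)\<^sup>2)) ^ (m + l)" for y
    using mult_mono[OF C(2)[of y] D(2)[of y]] C(1)
    by (simp add: abs_mult power_add mult.assoc mult.left_commute sum_nonneg)
  then show ?thesis unfolding poly_growth_def by blast
qed

lemma poly_growth_minus: "poly_growth n F \<Longrightarrow> poly_growth n (\<lambda>y. - F y)"
  by (simp add: poly_growth_def)

lemma poly_growth_diff:
  "poly_growth n F \<Longrightarrow> poly_growth n G \<Longrightarrow> poly_growth n (\<lambda>y. F y - G y)"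
  using poly_growth_add[of n F "\<lambda>y. - G y"] poly_growth_minus[of n G] by simp

lemma poly_growth_const: "poly_growth n (\<lambda>y. c)"
  unfolding poly_growth_def by (intro exI[of _ "\<bar>c\<bar>"] exI[of _ 0]) simp

lemma poly_growth_sum:
  "(\<And>k. k \<in> A \<Longrightarrow> poly_growth n (F k)) \<Longrightarrow> poly_growth n (\<lambda>y. \<Sum>k\<in>A. F k y)"
  by (induction A rule: infinite_finite_induct) (auto intro: poly_growth_add poly_growth_const)

lemma poly_growth_coordinate:
  assumes "k < n"
  shows "poly_growth n (\<lambda>y. y k)"
proof -
  have "\<bar>y k\<bar> \<le> 1 * (1 + (\<Sum>i<n. (y i)\<^sup>2)) ^ 1" for y :: "nat \<Rightarrow> real"
  proof -
    have "(y k)\<^sup>2 \<le> (\<Sum>i<n. (y i)\<^sup>2)" using assms by (intro member_le_sum) auto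
    then show ?thesis using abs_le_1_plus_square[of "y k"] by simp
  qed
  then show ?thesis unfolding poly_growth_def by blast
qed

lemma integrable_coordinate:
  fixes f :: "real \<Rightarrow> real"
  assumes "f \<in> borel_measurable borel"
  shows "integrable wiener (\<lambda>y. f (y k)) \<longleftrightarrow> integrable gauss f"
  using integrable_distr_eq[OF coordinate_measurable assms, of k] by (simp add: distr_coordinate)

text \<open>Replacing every square by the largest one dominates the power of the sum by a sum of
  functions of one coordinate each. Hence only moments of single coordinates enter, and no
  independence. The case n = 0 is separate because there is no maximum.\<close>

lemma integrable_poly_growth:
  assumes m: "F \<in> borel_measurable wiener" and g: "poly_growth n F"
  shows "integrable wiener F"
proof -
  obtain C m where C: "C \<ge> 0" "\<And>y. \<bar>F y\<bar> \<le> C * (1 + (\<Sum>i<n. (y i)\<^sup>2)) ^ m"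
    using g by (rule poly_growthE) blast
  have "(1 + (\<Sum>i<n. (y i)\<^sup>2)) ^ m \<le> real (n + 1) ^ m * (1 + (\<Sum>i<n. (1 + (y i)\<^sup>2) ^ m))" for y :: "nat \<Rightarrow> real"
  proof (cases "n = 0")
    case False
    define M where "M = Max ((\<lambda>i. (y i)\<^sup>2) ` {..<n})"
    have "M \<in> (\<lambda>i. (y i)\<^sup>2) ` {..<n}" unfolding M_def using False by (intro Max_in) auto
    then obtain j where j: "j < n" "M = (y j)\<^sup>2" by auto
    have "(\<Sum>i<n. (y i)\<^sup>2) \<le> (\<Sum>i<n. M)" unfolding M_def by (intro sum_mono Max_ge) auto
    then have "(\<Sum>i<n. (y i)\<^sup>2) \<le> real n * (y j)\<^sup>2" using j(2) by simp
    moreover have "real (n + 1) * (1 + (y j)\<^sup>2) = 1 + real n + (y j)\<^sup>2 + real n * (y j)\<^sup>2"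
      by (simp add: algebra_simps)
    ultimately have "1 + (\<Sum>i<n. (y i)\<^sup>2) \<le> real (n + 1) * (1 + (y j)\<^sup>2)"
      using zero_le_power2[of "y j"] by linarith
    then have "(1 + (\<Sum>i<n. (y i)\<^sup>2)) ^ m \<le> (real (n + 1) * (1 + (y j)\<^sup>2)) ^ m"
      by (intro power_mono add_nonneg_nonneg sum_nonneg) auto
    also have "\<dots> = real (n + 1) ^ m * (1 + (y j)\<^sup>2) ^ m" by (rule power_mult_distrib)
    also have "(1 + (y j)\<^sup>2) ^ m \<le> (\<Sum>i<n. (1 + (y i)\<^sup>2) ^ m)"
      using j(1) by (intro member_le_sum[where f = "\<lambda>i. (1 + (y i)\<^sup>2) ^ m"]) auto
    finally show ?thesis by (simp add: mult_left_mono order_trans)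
  qed simp
  then have b: "\<bar>F y\<bar> \<le> C * (real (n + 1) ^ m * (1 + (\<Sum>i<n. (1 + (y i)\<^sup>2) ^ m)))" for y
    using C by (meson mult_left_mono order_trans)
  show ?thesis
  proof (rule Bochner_Integration.integrable_bound[OF _ m])
    show "integrable wiener (\<lambda>y. C * (real (n + 1) ^ m * (1 + (\<Sum>i<n. (1 + (y i)\<^sup>2) ^ m))))"
      by (intro integrable_mult_right Bochner_Integration.integrable_add Bochner_Integration.integrable_sum)
         (auto simp: integrable_coordinate[where f = "\<lambda>t. (1 + t\<^sup>2) ^ m"] integrable_gauss_poly)
    show "AE y in wiener. norm (F y) \<le> norm (C * (real (n + 1) ^ m * (1 + (\<Sum>i<n. (1 + (y i)\<^sup>2) ^ m))))"
      using b by (intro AE_I2) (metis abs_ge_self order_trans real_norm_def)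
  qed
qed

lemma poly_growth_Lp:
  assumes m: "F \<in> borel_measurable wiener" and g: "poly_growth n F" and p: "p > 0"
  shows "F \<in> Lp p"
proof -
  obtain C m where C: "C \<ge> 0" "\<And>y. \<bar>F y\<bar> \<le> C * (1 + (\<Sum>i<n. (y i)\<^sup>2)) ^ m"
    using g by (rule poly_growthE) blast
  define N where "N = nat \<lceil>p\<rceil>"
  have N: "p \<le> real N" unfolding N_def by linarith
  have "\<bar>\<bar>F y\<bar> powr p\<bar> \<le> (C + 1) ^ N * (1 + (\<Sum>i<n. (y i)\<^sup>2)) ^ (m * N)" for y
  proof -
    let ?s = "1 + (\<Sum>i<n. (y i)\<^sup>2)"
    have s: "1 \<le> ?s" by (simp add: sum_nonneg)
    \<comment> \<open>C + 1 instead of C keeps the base at least 1, so that raising the exponent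
      from p to the integer N increases the power.\<close>
    have s1: "1 \<le> (C + 1) * ?s ^ m"
      using mult_mono[of 1 "C + 1" 1 "?s ^ m"] C(1) one_le_power[OF s] by simp
    have "\<bar>F y\<bar> \<le> (C + 1) * ?s ^ m"
      using C(2)[of y] s by (simp add: distrib_right add_increasing2)
    then have "\<bar>F y\<bar> powr p \<le> ((C + 1) * ?s ^ m) powr p"
      using p by (intro powr_mono2) auto
    also have "\<dots> \<le> ((C + 1) * ?s ^ m) powr real N"
      using N s1 by (rule powr_mono)
    also have "\<dots> = ((C + 1) * ?s ^ m) ^ N" using s1 by (intro powr_realpow) linarith
    finally show ?thesis by (simp add: power_mult_distrib power_mult)
  qed
  then have "poly_growth n (\<lambda>y. \<bar>F y\<bar> powr p)" unfolding poly_growth_def by blast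
  then show ?thesis
    using m by (auto simp: Lp_def intro!: integrable_poly_growth)
qed

subsection \<open>Smooth cylindrical functionals\<close>

text \<open>The number of coordinates is made explicit, since it bounds the sums for \<Gamma> and
  L.\<close>

definition smooth_cyl :: "nat \<Rightarrow> ((nat \<Rightarrow> real) \<Rightarrow> real) \<Rightarrow> bool" where
  "smooth_cyl n F \<longleftrightarrow> (\<forall>y z. (\<forall>i<n. y i = z i) \<longrightarrow> F y = F z) \<and>
     (\<forall>ks. continuous_on UNIV (iter_partial ks F) \<and>
           (\<forall>k y. (\<lambda>t. iter_partial ks F (y(k := t))) differentiable (at (y k))) \<and>
           poly_growth n (iter_partial ks F))"

lemma smooth_cylindrical_iff: "F \<in> smooth_cylindrical \<longleftrightarrow> (\<exists>n. smooth_cyl n F)"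
  by (simp add: smooth_cylindrical_def smooth_cyl_def poly_growth_def)

lemma smooth_cyl_mono: "smooth_cyl n F \<Longrightarrow> n \<le> n' \<Longrightarrow> smooth_cyl n' F"
  unfolding smooth_cyl_def using poly_growth_mono by (meson order_less_le_trans)

lemma partial_eq_0:
  assumes "smooth_cyl n F" "n \<le> k"
  shows "partial k F y = 0"
proof -
  have "F (y(k := t)) = F y" for t
    using assms unfolding smooth_cyl_def by (metis fun_upd_other leD)
  then show ?thesis by (simp add: partial_def)
qed

lemma iter_partial_append: "iter_partial (ks @ ls) F = iter_partial ks (iter_partial ls F)"
  by (induction ks) auto

lemma smooth_cyl_partial:
  assumes F: "smooth_cyl n F"
  shows "smooth_cyl n (partial k F)"
proof -
  have "iter_partial ks (partial k F) = iter_partial (ks @ [k]) F" for ks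
    by (simp add: iter_partial_append)
  moreover have "partial k F y = partial k F z" if e: "\<forall>i<n. y i = z i" for y z
  proof (cases "k < n")
    case True
    have "F (y(k := t)) = F (z(k := t))" for t
      using F e unfolding smooth_cyl_def by (simp add: fun_upd_def)
    then show ?thesis using True e by (simp add: partial_def)
  next
    case False
    then show ?thesis using partial_eq_0[OF F] by simp
  qed
  ultimately show ?thesis using F unfolding smooth_cyl_def by metis
qed

lemma smooth_cyl_growth: "smooth_cyl n F \<Longrightarrow> poly_growth n F"
  unfolding smooth_cyl_def by (metis iter_partial.simps(1))

lemma smooth_cyl_continuous: "smooth_cyl n F \<Longrightarrow> continuous_on UNIV F"
  unfolding smooth_cyl_def by (metis iter_partial.simps(1))

lemma smooth_cyl_measurable: "smooth_cyl n F \<Longrightarrow> F \<in> borel_measurable wiener"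
  by (rule continuous_measurable_wiener) (rule smooth_cyl_continuous)

lemma smooth_cyl_DERIV:
  assumes "smooth_cyl n F"
  shows "((\<lambda>t. F (y(k := t))) has_real_derivative partial k F (y(k := t))) (at t)"
proof -
  have "(\<lambda>s. iter_partial [] F ((y(k := t))(k := s))) differentiable (at ((y(k := t)) k))"
    using assms unfolding smooth_cyl_def by blast
  then show ?thesis by (simp add: partial_def DERIV_deriv_iff_real_differentiable)
qed

lemma partial_diff:
  assumes "smooth_cyl n F" "smooth_cyl l G"
  shows "partial k (\<lambda>y. F y - G y) = (\<lambda>y. partial k F y - partial k G y)"
proof
  fix y
  have "((\<lambda>t. F (y(k := t)) - G (y(k := t))) has_real_derivative
      partial k F (y(k := y k)) - partial k G (y(k := y k))) (at (y k))"
    by (intro derivative_intros smooth_cyl_DERIV[OF assms(1)] smooth_cyl_DERIV[OF assms(2)])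
  then show "partial k (\<lambda>y. F y - G y) y = partial k F y - partial k G y"
    unfolding partial_def by (simp add: DERIV_imp_deriv)
qed

lemma smooth_cyl_iter: "smooth_cyl n F \<Longrightarrow> smooth_cyl n (iter_partial ks F)"
  by (induction ks) (auto intro: smooth_cyl_partial)

lemma iter_partial_diff:
  assumes "smooth_cyl n F" "smooth_cyl l G"
  shows "iter_partial ks (\<lambda>y. F y - G y) = (\<lambda>y. iter_partial ks F y - iter_partial ks G y)"
  by (induction ks)
     (simp_all add: partial_diff[OF smooth_cyl_iter[OF assms(1)] smooth_cyl_iter[OF assms(2)]])

lemma smooth_cyl_diff:
  assumes F: "smooth_cyl n F" and G: "smooth_cyl n G"
  shows "smooth_cyl n (\<lambda>y. F y - G y)"
  unfolding smooth_cyl_def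
proof (intro conjI allI impI)
  fix y z :: "nat \<Rightarrow> real"
  assume "\<forall>i<n. y i = z i"
  then show "F y - G y = F z - G z" using F G unfolding smooth_cyl_def by metis
next
  fix ks
  show "continuous_on UNIV (iter_partial ks (\<lambda>y. F y - G y))"
    unfolding iter_partial_diff[OF F G]
    by (intro continuous_intros smooth_cyl_continuous[OF smooth_cyl_iter[OF F]]
        smooth_cyl_continuous[OF smooth_cyl_iter[OF G]])
  show "poly_growth n (iter_partial ks (\<lambda>y. F y - G y))"
    unfolding iter_partial_diff[OF F G]
    by (intro poly_growth_diff smooth_cyl_growth smooth_cyl_iter F G)
  show "(\<lambda>t. iter_partial ks (\<lambda>y. F y - G y) (y(k := t))) differentiable (at (y k))" for k y
    using F G unfolding iter_partial_diff[OF F G] smooth_cyl_def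
    by (intro differentiable_diff) blast+
qed

lemma smooth_cyl_integrable:
  assumes "smooth_cyl n F" "smooth_cyl n G"
  shows "integrable wiener (\<lambda>y. F y * G y)"
  using assms by (intro integrable_poly_growth[where n = n] poly_growth_mult
      borel_measurable_times smooth_cyl_measurable smooth_cyl_growth)

text \<open>A disjunction is enough because a product of partial derivatives vanishes as soon as one
  factor does. Thus the other functional may depend on more coordinates.\<close>

lemma cyl_Gamma_eq_sum:
  assumes "smooth_cyl n F \<or> smooth_cyl n G"
  shows "cyl_Gamma F G y = (\<Sum>k<n. partial k F y * partial k G y)"
  unfolding cyl_Gamma_def using assms by (intro suminf_finite) (auto simp: partial_eq_0)

lemma cyl_Gamma_integrable:
  assumes "smooth_cyl n F" "smooth_cyl n G"
  shows "integrable wiener (cyl_Gamma F G)"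
proof -
  have "integrable wiener (\<lambda>y. \<Sum>k<n. partial k F y * partial k G y)"
    using assms by (intro Bochner_Integration.integrable_sum smooth_cyl_integrable smooth_cyl_partial)
  moreover have "cyl_Gamma F G = (\<lambda>y. \<Sum>k<n. partial k F y * partial k G y)"
    using cyl_Gamma_eq_sum assms by blast
  ultimately show ?thesis by simp
qed

subsection \<open>Integration by parts\<close>

definition cyl_L :: "nat \<Rightarrow> ((nat \<Rightarrow> real) \<Rightarrow> real) \<Rightarrow> (nat \<Rightarrow> real) \<Rightarrow> real" where
  "cyl_L n R y = (\<Sum>k<n. partial k (partial k R) y - y k * partial k R y)"

lemma line_growth:
  assumes "poly_growth n F"
  obtains C m where "\<And>t. \<bar>F (y(k := t))\<bar> \<le> C * (1 + t\<^sup>2) ^ m"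
proof -
  obtain C m where C: "C \<ge> 0" "\<And>y. \<bar>F y\<bar> \<le> C * (1 + (\<Sum>i<n. (y i)\<^sup>2)) ^ m"
    using assms by (rule poly_growthE) blast
  let ?s = "1 + (\<Sum>i<n. (y i)\<^sup>2)"
  have "\<bar>F (y(k := t))\<bar> \<le> (C * ?s ^ m) * (1 + t\<^sup>2) ^ m" for t
  proof -
    have s: "?s \<ge> 1" by (simp add: sum_nonneg)
    have "(\<Sum>i<n. ((y(k := t)) i)\<^sup>2) \<le> (\<Sum>i<n. (y i)\<^sup>2 + (if i = k then t\<^sup>2 else 0))"
      by (intro sum_mono) auto
    also have "\<dots> \<le> (\<Sum>i<n. (y i)\<^sup>2) + t\<^sup>2" by (simp add: sum.distrib)
    finally have "1 + (\<Sum>i<n. ((y(k := t)) i)\<^sup>2) \<le> ?s + t\<^sup>2" by simp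
    also have "\<dots> \<le> ?s * (1 + t\<^sup>2)"
      using mult_right_mono[OF s zero_le_power2[of t]] by (simp add: algebra_simps)
    finally have "(1 + (\<Sum>i<n. ((y(k := t)) i)\<^sup>2)) ^ m \<le> (?s * (1 + t\<^sup>2)) ^ m"
      by (intro power_mono) (auto intro!: add_nonneg_nonneg sum_nonneg simp del: fun_upd_apply)
    then have "C * (1 + (\<Sum>i<n. ((y(k := t)) i)\<^sup>2)) ^ m \<le> C * (?s * (1 + t\<^sup>2)) ^ m"
      using C(1) by (rule mult_left_mono)
    then show ?thesis using C(2)[of "y(k := t)"] by (simp add: power_mult_distrib mult.assoc)
  qed
  then show thesis by (rule that)
qed

lemma continuous_on_fun_upd: "continuous_on UNIV (\<lambda>t. (y :: nat \<Rightarrow> real)(k := t))"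
proof (rule continuous_on_coordinatewise_then_product)
  show "continuous_on UNIV (\<lambda>t. (y(k := t)) i)" for i by (cases "i = k") auto
qed

text \<open>Along each line the product h of \<open>F\<close> and \<open>partial k R\<close> makes
  h' - t h the sum of the two integrands, so \<open>gauss_stein\<close> annihilates that sum line by
  line, and resampling coordinate \<open>k\<close> integrates over the lines.\<close>

lemma integration_by_parts_coordinate:
  assumes F: "smooth_cyl n F" and R: "smooth_cyl n R" and k: "k < n"
  shows "integrable wiener (\<lambda>y. F y * (partial k (partial k R) y - y k * partial k R y))"
    and "(\<integral>y. partial k F y * partial k R y \<partial>wiener) =
      - (\<integral>y. F y * (partial k (partial k R) y - y k * partial k R y) \<partial>wiener)"
proof -
  let ?D = "partial k R" and ?LR = "\<lambda>y. partial k (partial k R) y - y k * partial k R y"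
  have D: "smooth_cyl n ?D" "smooth_cyl n (partial k ?D)" "smooth_cyl n (partial k F)"
    using F R by (auto intro: smooth_cyl_partial)
  have gL: "poly_growth n ?LR"
    using D k by (intro poly_growth_diff poly_growth_mult poly_growth_coordinate smooth_cyl_growth)
  have mL: "?LR \<in> borel_measurable wiener"
    using D by (intro borel_measurable_diff borel_measurable_times coordinate_measurable smooth_cyl_measurable)
  show i1: "integrable wiener (\<lambda>y. F y * ?LR y)"
    by (intro integrable_poly_growth[where n = n] poly_growth_mult borel_measurable_times
        gL mL smooth_cyl_growth[OF F] smooth_cyl_measurable[OF F])
  have i2: "integrable wiener (\<lambda>y. partial k F y * ?D y)" using D by (intro smooth_cyl_integrable)
  let ?G = "\<lambda>y. partial k F y * ?D y + F y * ?LR y"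
  have "(\<integral>t. ?G (y(k := t)) \<partial>gauss) = 0" for y
  proof -
    let ?h = "\<lambda>t. F (y(k := t)) * ?D (y(k := t))"
    let ?h' = "\<lambda>t. partial k F (y(k := t)) * ?D (y(k := t)) + F (y(k := t)) * partial k ?D (y(k := t))"
    have "poly_growth n (\<lambda>y. F y * ?D y)"
      using F D by (intro poly_growth_mult smooth_cyl_growth)
    then obtain C m where C: "\<And>t. \<bar>?h t\<bar> \<le> C * (1 + t\<^sup>2) ^ m"
      by (rule line_growth) blast
    have "poly_growth n (\<lambda>y. partial k F y * ?D y + F y * partial k ?D y)"
      using F D by (intro poly_growth_mult poly_growth_add smooth_cyl_growth)
    then obtain C' m' where C': "\<And>t. \<bar>?h' t\<bar> \<le> C' * (1 + t\<^sup>2) ^ m'"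
      by (rule line_growth) blast
    have cont: "continuous_on UNIV (\<lambda>t. H (y(k := t)))" if "smooth_cyl n H" for H
      using continuous_on_compose2[OF smooth_cyl_continuous[OF that] continuous_on_fun_upd] by simp
    have "(\<integral>t. ?h' t - t * ?h t \<partial>gauss) = 0"
    proof (rule gauss_stein[OF _ _ C C'])
      show "(?h has_real_derivative ?h' t) (at t)" for t
        by (rule derivative_eq_intros smooth_cyl_DERIV[OF F] smooth_cyl_DERIV[OF D(1)] refl
            | simp add: algebra_simps)+
      show "continuous_on UNIV ?h'"
        by (intro continuous_intros cont F D)
    qed
    moreover have "(\<integral>t. ?G (y(k := t)) \<partial>gauss) = (\<integral>t. ?h' t - t * ?h t \<partial>gauss)"
      by (intro Bochner_Integration.integral_cong) (simp_all add: algebra_simps)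
    ultimately show ?thesis by simp
  qed
  then have "(\<integral>y. ?G y \<partial>wiener) = 0"
    using integral_resample[of ?G k] i1 i2 by simp
  then show "(\<integral>y. partial k F y * partial k R y \<partial>wiener) = - (\<integral>y. F y * ?LR y \<partial>wiener)"
    using i1 i2 by simp
qed

lemma integration_by_parts:
  assumes F: "smooth_cyl l F" and R: "smooth_cyl n R"
  shows "(\<integral>y. cyl_Gamma F R y \<partial>wiener) = - (\<integral>y. F y * cyl_L n R y \<partial>wiener)"
proof -
  \<comment> \<open>A common number of coordinates is needed for each single integration by parts,
    while the sum still runs up to n only, as R has no further derivatives.\<close>
  have F': "smooth_cyl (max l n) F" and R': "smooth_cyl (max l n) R"
    using F R by (auto intro: smooth_cyl_mono)
  note ibp = integration_by_parts_coordinate[OF F' R']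
  let ?L = "\<lambda>k y. partial k (partial k R) y - y k * partial k R y"
  have "(\<integral>y. cyl_Gamma F R y \<partial>wiener) = (\<integral>y. (\<Sum>k<n. partial k F y * partial k R y) \<partial>wiener)"
    using R by (intro Bochner_Integration.integral_cong refl cyl_Gamma_eq_sum) simp
  also have "\<dots> = (\<Sum>k<n. \<integral>y. partial k F y * partial k R y \<partial>wiener)"
    using F' R' by (intro Bochner_Integration.integral_sum smooth_cyl_integrable smooth_cyl_partial)
  also have "\<dots> = (\<Sum>k<n. - (\<integral>y. F y * ?L k y \<partial>wiener))"
    using ibp(2) by (intro sum.cong) auto
  also have "\<dots> = - (\<Sum>k<n. \<integral>y. F y * ?L k y \<partial>wiener)"
    by (rule sum_negf)
  also have "(\<Sum>k<n. \<integral>y. F y * ?L k y \<partial>wiener) = (\<integral>y. (\<Sum>k<n. F y * ?L k y) \<partial>wiener)"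
    using ibp(1) by (intro Bochner_Integration.integral_sum[symmetric]) auto
  finally show ?thesis by (simp add: cyl_L_def sum_distrib_left)
qed

lemma cyl_L_growth: "smooth_cyl n R \<Longrightarrow> poly_growth n (cyl_L n R)"
  unfolding cyl_L_def
  by (intro poly_growth_sum poly_growth_diff poly_growth_mult poly_growth_coordinate
      smooth_cyl_growth smooth_cyl_partial) auto

lemma cyl_L_measurable: "smooth_cyl n R \<Longrightarrow> cyl_L n R \<in> borel_measurable wiener"
  unfolding cyl_L_def
  by (intro borel_measurable_sum borel_measurable_diff borel_measurable_times coordinate_measurable
      smooth_cyl_measurable[where n = n] smooth_cyl_partial)

lemma cyl_L_Lp: "smooth_cyl n R \<Longrightarrow> p > 0 \<Longrightarrow> cyl_L n R \<in> Lp p"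
  by (rule poly_growth_Lp[OF cyl_L_measurable cyl_L_growth])

subsection \<open>Closability\<close>

lemma abs_mult_le_weighted_squares:
  fixes a b d :: real
  assumes "d > 0"
  shows "\<bar>a * b\<bar> \<le> d * a\<^sup>2 + b\<^sup>2 / d"
proof -
  have "0 \<le> (d * \<bar>a\<bar> - \<bar>b\<bar>)\<^sup>2 / d" using assms by simp
  also have "\<dots> = d * a\<^sup>2 + b\<^sup>2 / d - 2 * \<bar>a * b\<bar>"
    using assms by (simp add: power2_eq_square field_simps abs_mult)
  finally show ?thesis by linarith
qed

text \<open>This replaces Cauchy--Schwarz: optimizing over \<delta> for nonnegative d n would give
  the bound 2 sqrt(K d n). Keeping \<delta> free lets the pointwise inequality
  \<open>abs_mult_le_weighted_squares\<close> be integrated term by term.\<close>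

lemma tendsto_zero_weighted:
  fixes x d :: "nat \<Rightarrow> real"
  assumes K: "K \<ge> 0" and d: "d \<longlonglongrightarrow> 0"
    and x: "\<forall>\<^sub>F n in sequentially. \<forall>\<delta>>0. \<bar>x n\<bar> \<le> \<delta> * K + d n / \<delta>"
  shows "x \<longlonglongrightarrow> 0"
proof (rule tendstoI)
  fix e :: real assume e: "e > 0"
  define \<delta> where "\<delta> = e / (2 * (K + 1))"
  have \<delta>: "\<delta> > 0" using e K by (simp add: \<delta>_def)
  have K\<delta>: "\<delta> * K < e / 2" using e K by (simp add: \<delta>_def field_simps)
  have "\<forall>\<^sub>F n in sequentially. d n < \<delta> * (e / 2)"
    using d e \<delta> by (intro order_tendstoD(2)[OF d]) simp
  from this x show "\<forall>\<^sub>F n in sequentially. dist (x n) 0 < e"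
  proof eventually_elim
    case (elim n)
    have "d n / \<delta> < e / 2" using elim(1) \<delta> by (simp add: field_simps)
    moreover have "\<bar>x n\<bar> \<le> \<delta> * K + d n / \<delta>" using elim(2) \<delta> by blast
    ultimately have "\<bar>x n\<bar> < e" using K\<delta> by linarith
    then show ?case by simp
  qed
qed

lemma Lp_2_iff: "F \<in> Lp 2 \<longleftrightarrow> F \<in> borel_measurable wiener \<and> integrable wiener (\<lambda>y. (F y)\<^sup>2)"
  by (simp add: Lp_def)

lemma Lp_2_mult_integrable:
  assumes "F \<in> Lp 2" "H \<in> Lp 2"
  shows "integrable wiener (\<lambda>y. F y * H y)"
proof (rule Bochner_Integration.integrable_bound)
  show "integrable wiener (\<lambda>y. (F y)\<^sup>2 + (H y)\<^sup>2)"
    using assms by (auto simp: Lp_2_iff)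
  show "AE y in wiener. norm (F y * H y) \<le> norm ((F y)\<^sup>2 + (H y)\<^sup>2)"
    using abs_mult_le_weighted_squares[of 1] by (intro AE_I2) simp
  show "(\<lambda>y. F y * H y) \<in> borel_measurable wiener"
    using assms by (auto simp: Lp_2_iff)
qed

lemma Lp_2_diff:
  assumes "F \<in> Lp 2" "H \<in> Lp 2"
  shows "(\<lambda>y. F y - H y) \<in> Lp 2"
proof -
  have "(F y - H y)\<^sup>2 = (F y)\<^sup>2 - 2 * (F y * H y) + (H y)\<^sup>2" for y
    by (simp add: power2_diff)
  then show ?thesis
    using assms Lp_2_mult_integrable[OF assms] by (auto simp: Lp_2_iff)
qed

lemma tendsto_integral_mult:
  assumes F: "tendsto_Lp 2 Fs F" and H: "H \<in> Lp 2"
  shows "(\<lambda>n. \<integral>y. Fs n y * H y \<partial>wiener) \<longlonglongrightarrow> (\<integral>y. F y * H y \<partial>wiener)"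
proof -
  have L: "Fs n \<in> Lp 2" "F \<in> Lp 2" for n using F by (auto simp: tendsto_Lp_def)
  have D: "(\<lambda>y. Fs n y - F y) \<in> Lp 2" for n using L by (rule Lp_2_diff)
  have "(\<lambda>n. \<integral>y. (Fs n y - F y) * H y \<partial>wiener) \<longlonglongrightarrow> 0"
  proof (rule tendsto_zero_weighted)
    show "0 \<le> (\<integral>y. (H y)\<^sup>2 \<partial>wiener)" by simp
    show "(\<lambda>n. \<integral>y. (Fs n y - F y)\<^sup>2 \<partial>wiener) \<longlonglongrightarrow> 0"
      using F by (simp add: tendsto_Lp_def)
    show "\<forall>\<^sub>F n in sequentially. \<forall>\<delta>>0. \<bar>\<integral>y. (Fs n y - F y) * H y \<partial>wiener\<bar>
        \<le> \<delta> * (\<integral>y. (H y)\<^sup>2 \<partial>wiener) + (\<integral>y. (Fs n y - F y)\<^sup>2 \<partial>wiener) / \<delta>"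
    proof (intro always_eventually allI impI)
      fix n and \<delta> :: real assume \<delta>: "\<delta> > 0"
      have i: "integrable wiener (\<lambda>y. (H y)\<^sup>2)" "integrable wiener (\<lambda>y. (Fs n y - F y)\<^sup>2)"
        using H D[of n] by (auto simp: Lp_2_iff)
      have "\<bar>\<integral>y. (Fs n y - F y) * H y \<partial>wiener\<bar> \<le> (\<integral>y. \<bar>(Fs n y - F y) * H y\<bar> \<partial>wiener)"
        by (rule integral_abs_bound)
      also have "\<dots> \<le> (\<integral>y. \<delta> * (H y)\<^sup>2 + (Fs n y - F y)\<^sup>2 / \<delta> \<partial>wiener)"
        using i Lp_2_mult_integrable[OF D H] abs_mult_le_weighted_squares[OF \<delta>]
        by (intro integral_mono integrable_abs) (auto simp: mult.commute[of _ "H _"])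
      also have "\<dots> = \<delta> * (\<integral>y. (H y)\<^sup>2 \<partial>wiener) + (\<integral>y. (Fs n y - F y)\<^sup>2 \<partial>wiener) / \<delta>"
        using i by simp
      finally show "\<bar>\<integral>y. (Fs n y - F y) * H y \<partial>wiener\<bar>
        \<le> \<delta> * (\<integral>y. (H y)\<^sup>2 \<partial>wiener) + (\<integral>y. (Fs n y - F y)\<^sup>2 \<partial>wiener) / \<delta>" .
    qed
  qed
  then have "(\<lambda>n. (\<integral>y. Fs n y * H y \<partial>wiener) - (\<integral>y. F y * H y \<partial>wiener)) \<longlonglongrightarrow> 0"
    using L H by (simp add: left_diff_distrib Lp_2_mult_integrable)
  then show ?thesis by (simp add: LIM_zero_iff)
qed

section \<open>The Dirichlet form on cylindrical functionals\<close>

definition energy :: "((nat \<Rightarrow> real) \<Rightarrow> real) \<Rightarrow> ((nat \<Rightarrow> real) \<Rightarrow> real) \<Rightarrow> real" where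
  "energy F R = (\<integral>y. cyl_Gamma F R y \<partial>wiener)"

lemma smooth_cylindrical_common:
  assumes "F \<in> smooth_cylindrical" "R \<in> smooth_cylindrical"
  obtains n where "smooth_cyl n F" "smooth_cyl n R"
proof -
  obtain l m where "smooth_cyl l F" "smooth_cyl m R"
    using assms by (auto simp: smooth_cylindrical_iff)
  then have "smooth_cyl (max l m) F" "smooth_cyl (max l m) R"
    by (auto intro: smooth_cyl_mono)
  then show thesis by (rule that)
qed

lemma smooth_cylindrical_diff:
  assumes "F \<in> smooth_cylindrical" "R \<in> smooth_cylindrical"
  shows "(\<lambda>y. F y - R y) \<in> smooth_cylindrical"
  using smooth_cylindrical_common[OF assms] smooth_cyl_diff by (metis smooth_cylindrical_iff)

lemma smooth_cylindrical_Lp: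
  assumes "F \<in> smooth_cylindrical" "p > 0"
  shows "F \<in> Lp p"
  using assms poly_growth_Lp smooth_cyl_measurable smooth_cyl_growth
  by (metis smooth_cylindrical_iff)

lemma energy_nonneg:
  assumes "F \<in> smooth_cylindrical"
  shows "0 \<le> energy F F"
proof -
  obtain n where "smooth_cyl n F" using assms by (auto simp: smooth_cylindrical_iff)
  then show ?thesis
    by (auto simp: energy_def cyl_Gamma_eq_sum intro!: Bochner_Integration.integral_nonneg sum_nonneg)
qed

lemma energy_diff:
  assumes "F \<in> smooth_cylindrical" "R \<in> smooth_cylindrical"
  shows "energy (\<lambda>y. F y - R y) (\<lambda>y. F y - R y) = energy F F - 2 * energy F R + energy R R"
proof -
  obtain n where F: "smooth_cyl n F" and R: "smooth_cyl n R"
    using assms by (rule smooth_cylindrical_common)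
  have "cyl_Gamma (\<lambda>y. F y - R y) (\<lambda>y. F y - R y) y =
      cyl_Gamma F F y - 2 * cyl_Gamma F R y + cyl_Gamma R R y" for y
  proof -
    have "(\<Sum>k<n. (partial k F y - partial k R y) * (partial k F y - partial k R y)) =
        (\<Sum>k<n. partial k F y * partial k F y - 2 * (partial k F y * partial k R y) +
          partial k R y * partial k R y)"
      by (intro sum.cong) (auto simp: algebra_simps)
    then show ?thesis
      using F R smooth_cyl_diff[OF F R]
      by (simp add: cyl_Gamma_eq_sum[where n = n] partial_diff[OF F R] sum.distrib
          sum_subtractf sum_distrib_left)
  qed
  then show ?thesis
    using cyl_Gamma_integrable[OF F F] cyl_Gamma_integrable[OF F R] cyl_Gamma_integrable[OF R R]
    by (simp add: energy_def)
qed

lemma energy_diff_right: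
  assumes "F \<in> smooth_cylindrical" "R \<in> smooth_cylindrical" "U \<in> smooth_cylindrical"
  shows "energy F (\<lambda>y. R y - U y) = energy F R - energy F U"
proof -
  obtain l where F: "smooth_cyl l F" using assms by (auto simp: smooth_cylindrical_iff)
  obtain m where R: "smooth_cyl m R" and U: "smooth_cyl m U"
    using assms(2,3) by (rule smooth_cylindrical_common)
  let ?n = "max l m"
  have n: "smooth_cyl ?n F" "smooth_cyl ?n R" "smooth_cyl ?n U" using F R U by (auto intro: smooth_cyl_mono)
  have "cyl_Gamma F (\<lambda>y. R y - U y) y = cyl_Gamma F R y - cyl_Gamma F U y" for y
    using n by (simp add: cyl_Gamma_eq_sum[where n = ?n] partial_diff[OF R U] sum_subtractf right_diff_distrib)
  then show ?thesis
    using cyl_Gamma_integrable[OF n(1,2)] cyl_Gamma_integrable[OF n(1,3)] by (simp add: energy_def)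
qed

lemma energy_weighted_bound:
  assumes "F \<in> smooth_cylindrical" "R \<in> smooth_cylindrical" and d: "d > 0"
  shows "\<bar>energy F R\<bar> \<le> d * energy F F + energy R R / d"
proof -
  obtain n where F: "smooth_cyl n F" and R: "smooth_cyl n R"
    using assms(1,2) by (rule smooth_cylindrical_common)
  have b: "\<bar>cyl_Gamma F R y\<bar> \<le> d * cyl_Gamma F F y + cyl_Gamma R R y / d" for y
  proof -
    have "\<bar>\<Sum>k<n. partial k F y * partial k R y\<bar> \<le> (\<Sum>k<n. \<bar>partial k F y * partial k R y\<bar>)"
      by (rule sum_abs)
    also have "\<dots> \<le> (\<Sum>k<n. d * (partial k F y)\<^sup>2 + (partial k R y)\<^sup>2 / d)"
      by (intro sum_mono abs_mult_le_weighted_squares d)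
    also have "\<dots> = d * (\<Sum>k<n. (partial k F y)\<^sup>2) + (\<Sum>k<n. (partial k R y)\<^sup>2) / d"
      by (simp add: sum.distrib sum_distrib_left sum_divide_distrib)
    finally show ?thesis using F R by (simp add: cyl_Gamma_eq_sum[where n = n] power2_eq_square)
  qed
  note i = cyl_Gamma_integrable[OF F F] cyl_Gamma_integrable[OF F R] cyl_Gamma_integrable[OF R R]
  have "\<bar>energy F R\<bar> \<le> (\<integral>y. \<bar>cyl_Gamma F R y\<bar> \<partial>wiener)"
    unfolding energy_def by (rule integral_abs_bound)
  also have "\<dots> \<le> (\<integral>y. d * cyl_Gamma F F y + cyl_Gamma R R y / d \<partial>wiener)"
    using i b by (intro integral_mono integrable_abs) auto
  also have "\<dots> = d * energy F F + energy R R / d" using i by (simp add: energy_def)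
  finally show ?thesis .
qed

text \<open>
  With \<open>U\<^sub>n = R\<^sub>n - R\<close>, the identity
  \<open>E(U\<^sub>n) + E(U\<^sub>m) = E(U\<^sub>n - U\<^sub>m) + 2 E(U\<^sub>m, U\<^sub>n)\<close> bounds \<open>E(U\<^sub>n)\<close>: the first term on the right is small
  by the Cauchy property, and the second is \<open>-2 \<langle>U\<^sub>m, L U\<^sub>n\<rangle>\<close>, which vanishes as \<open>m\<close> grows.
\<close>
lemma form_approx_energy_tendsto:
  assumes Rs: "form_approx Rs R" and R: "R \<in> smooth_cylindrical"
  shows "(\<lambda>n. energy (\<lambda>y. Rs n y - R y) (\<lambda>y. Rs n y - R y)) \<longlonglongrightarrow> 0"
proof (rule LIMSEQ_I)
  fix e :: real assume e: "e > 0"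
  define U where "U = (\<lambda>n y. Rs n y - R y)"
  have S: "Rs n \<in> smooth_cylindrical" for n using Rs by (simp add: form_approx_def)
  have U: "U n \<in> smooth_cylindrical" for n unfolding U_def by (rule smooth_cylindrical_diff[OF S R])
  have U0: "tendsto_Lp 2 U (\<lambda>y. 0)"
    using Rs U smooth_cylindrical_Lp[OF U, of 2] unfolding form_approx_def tendsto_Lp_def
    by (simp add: U_def Lp_2_iff)
  have "e / 2 > 0" using e by simp
  then obtain N where N: "\<And>m n. m \<ge> N \<Longrightarrow> n \<ge> N \<Longrightarrow>
      energy (\<lambda>z. Rs m z - Rs n z) (\<lambda>z. Rs m z - Rs n z) < e / 2"
    using Rs unfolding form_approx_def energy_def by blast
  \<comment> \<open>The limit in m yields only a weak inequality, hence the target e/2 rather than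
    e.\<close>
  have "energy (U n) (U n) \<le> e / 2" if n: "n \<ge> N" for n
  proof -
    obtain l where l: "smooth_cyl l (U n)" using U by (auto simp: smooth_cylindrical_iff)
    have "cyl_L l (U n) \<in> Lp 2"
      using l by (rule cyl_L_Lp) simp
    then have "(\<lambda>m. \<integral>y. U m y * cyl_L l (U n) y \<partial>wiener) \<longlonglongrightarrow> 0"
      using tendsto_integral_mult[OF U0] by simp
    then have "(\<lambda>m. e / 2 - 2 * (\<integral>y. U m y * cyl_L l (U n) y \<partial>wiener)) \<longlonglongrightarrow> e / 2 - 2 * 0"
      by (intro tendsto_intros)
    moreover have "energy (U n) (U n) \<le> e / 2 - 2 * (\<integral>y. U m y * cyl_L l (U n) y \<partial>wiener)"
      if m: "m \<ge> N" for m
    proof -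
      obtain k where k: "smooth_cyl k (U m)" using U by (auto simp: smooth_cylindrical_iff)
      have "(\<lambda>y. U m y - U n y) = (\<lambda>y. Rs m y - Rs n y)" by (simp add: U_def)
      then have "energy (U m) (U m) - 2 * energy (U m) (U n) + energy (U n) (U n) < e / 2"
        using N[OF m n] energy_diff[OF U[of m] U[of n]] by simp
      moreover have "energy (U m) (U n) = - (\<integral>y. U m y * cyl_L l (U n) y \<partial>wiener)"
        unfolding energy_def by (rule integration_by_parts[OF k l])
      ultimately show ?thesis using energy_nonneg[OF U[of m]] by linarith
    qed
    ultimately show ?thesis using LIMSEQ_le_const by fastforce
  qed
  then have "\<bar>energy (U n) (U n)\<bar> < e" if "n \<ge> N" for n
    using e energy_nonneg[OF U[of n]] that by fastforce
  then show "\<exists>no. \<forall>n\<ge>no. norm (energy (\<lambda>y. Rs n y - R y) (\<lambda>y. Rs n y - R y) - 0) < e"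
    unfolding U_def by auto
qed

lemma form_approx_energy_bounded:
  assumes Fs: "form_approx Fs F"
  obtains K where "K \<ge> 0" "\<forall>\<^sub>F n in sequentially. energy (Fs n) (Fs n) \<le> K"
proof -
  have S: "Fs n \<in> smooth_cylindrical" for n using Fs by (simp add: form_approx_def)
  obtain N where N: "\<And>m n. m \<ge> N \<Longrightarrow> n \<ge> N \<Longrightarrow>
      energy (\<lambda>z. Fs m z - Fs n z) (\<lambda>z. Fs m z - Fs n z) < 1"
    using Fs unfolding form_approx_def energy_def by (meson zero_less_one)
  have "energy (Fs n) (Fs n) \<le> 2 + 16 * energy (Fs N) (Fs N)" if n: "n \<ge> N" for n
  proof -
    have "energy (Fs n) (Fs n) - 2 * energy (Fs n) (Fs N) + energy (Fs N) (Fs N) < 1"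
      using N[OF n order.refl] energy_diff[OF S S] by simp
    \<comment> \<open>The mixed term occurs with factor 2, so the weight 1/4 lets half of
      \<open>energy (Fs n) (Fs n)\<close> be absorbed on the left.\<close>
    moreover have "\<bar>energy (Fs n) (Fs N)\<bar> \<le> 1/4 * energy (Fs n) (Fs n) + energy (Fs N) (Fs N) / (1/4)"
      by (rule energy_weighted_bound[OF S S]) simp
    ultimately show ?thesis using energy_nonneg[OF S[of N]] by (simp add: abs_le_iff)
  qed
  moreover have "0 \<le> 2 + 16 * energy (Fs N) (Fs N)" using energy_nonneg[OF S] by simp
  ultimately show thesis by (intro that) (auto simp: eventually_sequentially)
qed

lemma form_approx_const:
  assumes "R \<in> smooth_cylindrical"
  shows "form_approx (\<lambda>_. R) R"
proof -
  have "cyl_Gamma (\<lambda>z. R z - R z) (\<lambda>z. R z - R z) = (\<lambda>y. 0)"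
    by (intro ext) (simp add: cyl_Gamma_def partial_def)
  then show ?thesis
    using assms smooth_cylindrical_Lp[OF assms, of 2] by (simp add: form_approx_def tendsto_Lp_def)
qed

text \<open>The energies of \<open>Fs j\<close> and \<open>Rs j\<close> have two limits to be
  compared. Convergence of \<Gamma> in L^1 gives the integral of \<open>G\<close>. Splitting
  \<open>Rs j\<close> into \<open>R\<close> and a remainder gives the other: integration by parts
  moves all derivatives onto the fixed \<open>R\<close>, so that L^2 convergence of
  \<open>Fs\<close> is enough, and the remainder contributes nothing in the limit because its energy
  tends to 0 while that of \<open>Fs j\<close> stays bounded.\<close>

lemma OU_generator_smooth_cyl:
  assumes R: "smooth_cyl n R"
  shows "OU_generator R (cyl_L n R)"
  unfolding OU_generator_def
proof (intro conjI ballI allI impI)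
  have Rc: "R \<in> smooth_cylindrical" using R by (auto simp: smooth_cylindrical_iff)
  show "R \<in> form_domain" using form_approx_const[OF Rc] by (auto simp: form_domain_def)
  show H: "cyl_L n R \<in> Lp 2" using R by (rule cyl_L_Lp) simp
  fix F G assume "carre_du_champ F R G"
  then obtain Fs Rs where Fs: "form_approx Fs F" and Rs: "form_approx Rs R"
    and G: "tendsto_Lp 1 (\<lambda>j. cyl_Gamma (Fs j) (Rs j)) G"
    unfolding carre_du_champ_def by blast
  have S: "Fs j \<in> smooth_cylindrical" "Rs j \<in> smooth_cylindrical" for j
    using Fs Rs by (auto simp: form_approx_def)
  have "(\<lambda>j. energy (Fs j) (Rs j)) \<longlonglongrightarrow> (\<integral>y. G y \<partial>wiener)"
  proof -
    have i: "integrable wiener (cyl_Gamma (Fs j) (Rs j))" "integrable wiener G" for j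
      using G unfolding tendsto_Lp_def Lp_def
      by (auto intro: integrable_abs_iff[THEN iffD1])
    have "(\<lambda>j. \<integral>y. \<bar>cyl_Gamma (Fs j) (Rs j) y - G y\<bar> \<partial>wiener) \<longlonglongrightarrow> 0"
      using G by (simp add: tendsto_Lp_def)
    then have "(\<lambda>j. energy (Fs j) (Rs j) - (\<integral>y. G y \<partial>wiener)) \<longlonglongrightarrow> 0"
    proof (rule Lim_null_comparison[rotated])
      have "norm (energy (Fs j) (Rs j) - (\<integral>y. G y \<partial>wiener))
          \<le> (\<integral>y. \<bar>cyl_Gamma (Fs j) (Rs j) y - G y\<bar> \<partial>wiener)" for j
        using i integral_abs_bound[of wiener "\<lambda>y. cyl_Gamma (Fs j) (Rs j) y - G y"]
        by (simp add: energy_def)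
      then show "\<forall>\<^sub>F j in sequentially. norm (energy (Fs j) (Rs j) - (\<integral>y. G y \<partial>wiener))
          \<le> (\<integral>y. \<bar>cyl_Gamma (Fs j) (Rs j) y - G y\<bar> \<partial>wiener)" by simp
    qed
    then show ?thesis by (simp add: LIM_zero_iff)
  qed
  moreover have "(\<lambda>j. energy (Fs j) (Rs j)) \<longlonglongrightarrow> - (\<integral>y. F y * cyl_L n R y \<partial>wiener)"
  proof -
    have e: "energy (Fs j) R = - (\<integral>y. Fs j y * cyl_L n R y \<partial>wiener)" for j
      using S(1)[of j] R unfolding energy_def by (auto simp: smooth_cylindrical_iff intro: integration_by_parts)
    have "tendsto_Lp 2 Fs F" using Fs by (simp add: form_approx_def)
    then have l1: "(\<lambda>j. energy (Fs j) R) \<longlonglongrightarrow> - (\<integral>y. F y * cyl_L n R y \<partial>wiener)"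
      unfolding e by (intro tendsto_minus tendsto_integral_mult H)
    obtain K where K: "K \<ge> 0" "\<forall>\<^sub>F j in sequentially. energy (Fs j) (Fs j) \<le> K"
      using Fs by (rule form_approx_energy_bounded)
    let ?U = "\<lambda>j y. Rs j y - R y"
    have "(\<lambda>j. energy (Fs j) (?U j)) \<longlonglongrightarrow> 0"
    proof (rule tendsto_zero_weighted[OF K(1) form_approx_energy_tendsto[OF Rs Rc]])
      show "\<forall>\<^sub>F j in sequentially. \<forall>\<delta>>0. \<bar>energy (Fs j) (?U j)\<bar> \<le> \<delta> * K + energy (?U j) (?U j) / \<delta>"
        using K(2)
      proof eventually_elim
        case (elim j)
        show ?case
        proof (intro allI impI)
          fix \<delta> :: real assume \<delta>: "\<delta> > 0"
          show "\<bar>energy (Fs j) (?U j)\<bar> \<le> \<delta> * K + energy (?U j) (?U j) / \<delta>"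
            using energy_weighted_bound[OF S(1)[of j] smooth_cylindrical_diff[OF S(2)[of j] Rc] \<delta>]
              mult_left_mono[OF elim, of \<delta>] \<delta> by linarith
        qed
      qed
    qed
    then have "(\<lambda>j. energy (Fs j) R + energy (Fs j) (?U j)) \<longlonglongrightarrow> - (\<integral>y. F y * cyl_L n R y \<partial>wiener) + 0"
      by (intro tendsto_add l1)
    then show ?thesis by (simp add: energy_diff_right[OF S(1) S(2) Rc])
  qed
  ultimately show "(\<integral>y. G y \<partial>wiener) = - (\<integral>y. F y * cyl_L n R y \<partial>wiener)"
    by (rule LIMSEQ_unique)
qed

subsection \<open>Functions of a single coordinate\<close>

text \<open>Closure under differentiation turns one derivative and one growth bound into smoothness
  with polynomial growth at every order. The identity is included because of the drift term of the
  generator.\<close>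

locale gaussian_algebra =
  fixes \<A> :: "(real \<Rightarrow> real) set"
  assumes ident: "(\<lambda>t. t) \<in> \<A>"
    and const: "(\<lambda>t. c) \<in> \<A>"
    and add: "f \<in> \<A> \<Longrightarrow> g \<in> \<A> \<Longrightarrow> (\<lambda>t. f t + g t) \<in> \<A>"
    and mult: "f \<in> \<A> \<Longrightarrow> g \<in> \<A> \<Longrightarrow> (\<lambda>t. f t * g t) \<in> \<A>"
    and has_deriv: "f \<in> \<A> \<Longrightarrow> \<exists>f'\<in>\<A>. \<forall>t. (f has_real_derivative f' t) (at t)"
    and growth: "f \<in> \<A> \<Longrightarrow> \<exists>C m. \<forall>t. \<bar>f t\<bar> \<le> C * (1 + t\<^sup>2) ^ m"
begin

lemma deriv_mem:
  assumes "f \<in> \<A>"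
  shows "deriv f \<in> \<A>" "(f has_real_derivative deriv f t) (at t)"
proof -
  obtain f' where f': "f' \<in> \<A>" "\<And>t. (f has_real_derivative f' t) (at t)"
    using has_deriv[OF assms] by blast
  then have "deriv f = f'" by (auto intro: DERIV_imp_deriv)
  then show "deriv f \<in> \<A>" "(f has_real_derivative deriv f t) (at t)" using f' by auto
qed

lemma funpow_deriv_mem: "f \<in> \<A> \<Longrightarrow> (deriv ^^ n) f \<in> \<A>"
  by (induction n) (auto intro: deriv_mem)

lemma partial_coordinate_0:
  "partial k (\<lambda>y. f (y 0)) = (\<lambda>y. if k = 0 then deriv f (y 0) else 0)"
  by (auto simp: partial_def fun_eq_iff)

lemma iter_partial_coordinate_0:
  "iter_partial ks (\<lambda>y. f (y 0)) =
    (\<lambda>y. if set ks \<subseteq> {0} then (deriv ^^ length ks) f (y 0) else 0)"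
proof (induction ks)
  case (Cons k ks)
  show ?case
  proof (cases "set ks \<subseteq> {0}")
    case True
    then have "iter_partial (k # ks) (\<lambda>y. f (y 0)) = partial k (\<lambda>y. (deriv ^^ length ks) f (y 0))"
      by (simp add: Cons.IH)
    then show ?thesis using True by (auto simp: partial_coordinate_0)
  next
    case False
    then have "iter_partial (k # ks) (\<lambda>y. f (y 0)) = partial k (\<lambda>y. 0)"
      using Cons.IH by simp
    then show ?thesis using False by (auto simp: partial_def)
  qed
qed simp

lemma smooth_cyl_coordinate_0:
  assumes f: "f \<in> \<A>"
  shows "smooth_cyl 1 (\<lambda>y. f (y 0))"
  unfolding smooth_cyl_def
proof (intro conjI allI impI)
  show "f (y 0) = f (z 0)" if "\<forall>i<(1::nat). y i = z i" for y z :: "nat \<Rightarrow> real" using that by simp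
next
  fix ks :: "nat list"
  define g where "g = (if set ks \<subseteq> {0} then (deriv ^^ length ks) f else (\<lambda>t. 0))"
  have g: "g \<in> \<A>" unfolding g_def using funpow_deriv_mem[OF f] const by simp
  have eq: "iter_partial ks (\<lambda>y. f (y 0)) = (\<lambda>y. g (y 0))"
    by (simp add: iter_partial_coordinate_0 g_def fun_eq_iff)
  have cg: "continuous_on UNIV g"
    by (rule DERIV_continuous_on, rule has_field_derivative_at_within, rule deriv_mem(2)[OF g])
  show "continuous_on UNIV (iter_partial ks (\<lambda>y. f (y 0)))"
    unfolding eq by (rule continuous_on_compose2[OF cg]) (auto intro: continuous_on_product_coordinates)
  obtain C m where "\<And>t. \<bar>g t\<bar> \<le> C * (1 + t\<^sup>2) ^ m" using growth[OF g] by blast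
  then show "poly_growth 1 (iter_partial ks (\<lambda>y. f (y 0)))"
    unfolding eq poly_growth_def by (intro exI[of _ C] exI[of _ m]) simp
  show "(\<lambda>t. iter_partial ks (\<lambda>y. f (y 0)) (y(k := t))) differentiable (at (y k))" for k y
  proof (cases "k = 0")
    case True
    then show ?thesis unfolding eq
      using deriv_mem(2)[OF g, of "y k"] by (auto simp: real_differentiable_def)
  qed (simp add: eq)
qed

definition ornstein_uhlenbeck :: "(real \<Rightarrow> real) \<Rightarrow> real \<Rightarrow> real" where
  "ornstein_uhlenbeck f = (\<lambda>t. deriv (deriv f) t - t * deriv f t)"

lemma ornstein_uhlenbeck_mem:
  assumes "f \<in> \<A>"
  shows "ornstein_uhlenbeck f \<in> \<A>"
proof -
  have "(\<lambda>t. deriv (deriv f) t + (-1) * (t * deriv f t)) \<in> \<A>"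
    using assms by (intro add mult const ident deriv_mem)
  then show ?thesis by (simp add: ornstein_uhlenbeck_def)
qed

text \<open>The iterates of the generator never leave the algebra, so each is again smooth
  cylindrical. \<open>OU_generator_smooth_cyl\<close> then applies at every level, and polynomial
  growth gives all L^p bounds.\<close>

lemma D_infty_coordinate_0:
  assumes f: "f \<in> \<A>"
  shows "(\<lambda>y. f (y 0)) \<in> D_infty"
proof -
  define H where "H = (\<lambda>n (y::nat \<Rightarrow> real). (ornstein_uhlenbeck ^^ n) f (y 0))"
  have mem: "(ornstein_uhlenbeck ^^ n) f \<in> \<A>" for n
    by (induction n) (auto intro: f ornstein_uhlenbeck_mem)
  have S: "smooth_cyl 1 (H n)" for n unfolding H_def by (rule smooth_cyl_coordinate_0[OF mem])
  have "cyl_L 1 (H n) = H (Suc n)" for n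
    by (simp add: fun_eq_iff cyl_L_def H_def partial_coordinate_0 ornstein_uhlenbeck_def)
  then have "OU_generator (H n) (H (Suc n))" for n
    using OU_generator_smooth_cyl[OF S] by metis
  moreover have "H n \<in> Lp p" if "p > 1" for n p
    using that by (intro poly_growth_Lp[OF smooth_cyl_measurable[OF S] smooth_cyl_growth[OF S]]) simp
  ultimately show ?thesis
    unfolding D_infty_def by (intro CollectI exI[of _ H]) (simp add: H_def)
qed

lemma carre_du_champ_coordinate_0:
  assumes f: "f \<in> \<A>"
  shows "carre_du_champ (\<lambda>y. f (y 0)) (\<lambda>y. f (y 0)) (\<lambda>y. (deriv f (y 0))\<^sup>2)"
proof -
  let ?X = "\<lambda>y::nat \<Rightarrow> real. f (y 0)" and ?G = "\<lambda>y::nat \<Rightarrow> real. (deriv f (y 0))\<^sup>2"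
  have S: "smooth_cyl 1 ?X" by (rule smooth_cyl_coordinate_0[OF f])
  have G: "cyl_Gamma ?X ?X = ?G"
    using S by (simp add: fun_eq_iff cyl_Gamma_eq_sum[where n = 1] partial_coordinate_0 power2_eq_square)
  have "(\<lambda>t. deriv f t * deriv f t) \<in> \<A>" by (intro mult deriv_mem f)
  then have "smooth_cyl 1 ?G"
    using smooth_cyl_coordinate_0 by (fastforce simp: power2_eq_square)
  then have "?G \<in> Lp 1" by (intro smooth_cylindrical_Lp) (auto simp: smooth_cylindrical_iff)
  then have "tendsto_Lp 1 (\<lambda>_. cyl_Gamma ?X ?X) ?G"
    unfolding G by (simp add: tendsto_Lp_def)
  moreover have "form_approx (\<lambda>_. ?X) ?X"
    using S by (intro form_approx_const) (auto simp: smooth_cylindrical_iff)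
  ultimately show ?thesis unfolding carre_du_champ_def by blast
qed

end

section \<open>Differential algebras given by generators\<close>

inductive_set generated_algebra :: "('a \<Rightarrow> real) set \<Rightarrow> ('a \<Rightarrow> real) set" for S where
  generator: "f \<in> S \<Longrightarrow> f \<in> generated_algebra S"
| const: "(\<lambda>t. c) \<in> generated_algebra S"
| add: "f \<in> generated_algebra S \<Longrightarrow> g \<in> generated_algebra S \<Longrightarrow> (\<lambda>t. f t + g t) \<in> generated_algebra S"
| mult: "f \<in> generated_algebra S \<Longrightarrow> g \<in> generated_algebra S \<Longrightarrow> (\<lambda>t. f t * g t) \<in> generated_algebra S"

lemma gaussian_algebra_generated:
  assumes ident: "(\<lambda>t. t) \<in> S"
    and deriv: "\<And>f. f \<in> S \<Longrightarrow> \<exists>f'\<in>generated_algebra S. \<forall>t. (f has_real_derivative f' t) (at t)"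
    and growth: "\<And>f. f \<in> S \<Longrightarrow> \<exists>C m. \<forall>t. \<bar>f t\<bar> \<le> C * (1 + t\<^sup>2) ^ m"
  shows "gaussian_algebra (generated_algebra S)"
proof
  fix f assume "f \<in> generated_algebra S"
  then show "\<exists>f'\<in>generated_algebra S. \<forall>t. (f has_real_derivative f' t) (at t)"
  proof induction
    case (generator f)
    then show ?case by (rule deriv)
  next
    case (const c)
    then show ?case by (intro bexI[of _ "\<lambda>t. 0"]) (auto intro: generated_algebra.const)
  next
    case (add f g)
    then obtain f' g' where "f' \<in> generated_algebra S" "g' \<in> generated_algebra S"
      "\<And>t. (f has_real_derivative f' t) (at t)" "\<And>t. (g has_real_derivative g' t) (at t)" by blast
    then show ?case
      by (intro bexI[of _ "\<lambda>t. f' t + g' t"]) (auto intro: generated_algebra.add intro!: derivative_intros)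
  next
    case (mult f g)
    then obtain f' g' where D: "f' \<in> generated_algebra S" "g' \<in> generated_algebra S"
      "\<And>t. (f has_real_derivative f' t) (at t)" "\<And>t. (g has_real_derivative g' t) (at t)" by blast
    have "((\<lambda>t. f t * g t) has_real_derivative f' t * g t + g' t * f t) (at t)" for t
      by (rule DERIV_mult[OF D(3,4)])
    then show ?case using mult.hyps D(1,2)
      by (intro bexI[of _ "\<lambda>t. f' t * g t + g' t * f t"]) (auto intro: generated_algebra.intros)
  qed
next
  fix f assume "f \<in> generated_algebra S"
  \<comment> \<open>Regarding f as a functional of one coordinate makes the closure rules for
    \<open>poly_growth\<close> available for the induction.\<close>
  then have "poly_growth 1 (\<lambda>y. f (y 0))"
  proof induction
    case (generator f)
    then obtain C m where "\<And>t. \<bar>f t\<bar> \<le> C * (1 + t\<^sup>2) ^ m" using growth by blast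
    then show ?case unfolding poly_growth_def by (intro exI[of _ C] exI[of _ m]) simp
  qed (auto intro: poly_growth_const poly_growth_add poly_growth_mult)
  then obtain C m where C: "\<And>y :: nat \<Rightarrow> real. \<bar>f (y 0)\<bar> \<le> C * (1 + (y 0)\<^sup>2) ^ m"
    by (auto simp: poly_growth_def)
  have "\<bar>f t\<bar> \<le> C * (1 + t\<^sup>2) ^ m" for t using C[of "\<lambda>_. t"] .
  then show "\<exists>C m. \<forall>t. \<bar>f t\<bar> \<le> C * (1 + t\<^sup>2) ^ m" by blast
qed (auto intro: generated_algebra.intros ident)

subsection \<open>Distribution functions of absolutely continuous laws\<close>

lemma real_distribution_density:
  fixes f :: "real \<Rightarrow> real"
  assumes "prob_space (density lborel (\<lambda>x. ennreal (f x)))"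
  shows "real_distribution (density lborel (\<lambda>x. ennreal (f x)))"
  using assms by (simp add: real_distribution_def real_distribution_axioms_def)

lemma measure_density_lborel:
  fixes f :: "real \<Rightarrow> real"
  assumes f: "integrable lborel f" "\<And>x. 0 \<le> f x" and S: "S \<in> sets borel"
  shows "measure (density lborel (\<lambda>x. ennreal (f x))) S = (LINT x:S|lborel. f x)"
proof -
  have i: "integrable lborel (\<lambda>x. indicator S x * f x)"
    using f(1) S integrable_mult_indicator[of S lborel f] by simp
  have "emeasure (density lborel (\<lambda>x. ennreal (f x))) S = (\<integral>\<^sup>+x. ennreal (indicator S x * f x) \<partial>lborel)"
    using f S by (subst emeasure_density) (auto intro!: nn_integral_cong split: split_indicator)
  also have "\<dots> = ennreal (\<integral>x. indicator S x * f x \<partial>lborel)"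
    using f i by (intro nn_integral_eq_integral) auto
  finally show ?thesis
    using f(2) by (simp add: measure_def set_lebesgue_integral_def Bochner_Integration.integral_nonneg)
qed

text \<open>Near x the distribution function is a constant plus the integral of f from a nearby
  point, so continuity of f on a neighbourhood is enough. This locality matters for the Beta
  density, which may blow up at the endpoints.\<close>

lemma cdf_density_DERIV:
  fixes f :: "real \<Rightarrow> real"
  assumes f: "integrable lborel f" "\<And>x. 0 \<le> f x"
    and p: "prob_space (density lborel (\<lambda>x. ennreal (f x)))"
    and I: "open I" "continuous_on I f" "x \<in> I"
  shows "(cdf (density lborel (\<lambda>x. ennreal (f x))) has_real_derivative f x) (at x)"
proof -
  let ?M = "density lborel (\<lambda>x. ennreal (f x))"
  interpret M: real_distribution ?M by (rule real_distribution_density[OF p])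
  obtain e where e: "e > 0" "cball x e \<subseteq> I" using I(1,3) open_contains_cball by blast
  let ?c = "x - e" and ?d = "x + e"
  have cf: "continuous_on {?c..?d} f"
    using e(2) I(2) by (auto intro: continuous_on_subset simp: cball_eq_atLeastAtMost)
  have eq: "cdf ?M u = cdf ?M ?c + integral {?c..u} f" if u: "u \<in> {?c..?d}" for u
  proof (cases "u = ?c")
    case False
    then have cu: "?c < u" using u by simp
    have si: "set_integrable lborel {?c..u} f"
      using integrable_mult_indicator[of "{?c..u}" lborel f] f(1) by (simp add: set_integrable_def)
    have "cdf ?M u - cdf ?M ?c = measure ?M {?c<..u}" by (rule M.cdf_diff_eq[OF cu])
    also have "\<dots> = (LINT x:{?c<..u}|lborel. f x)"
      by (rule measure_density_lborel[OF f]) simp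
    also have "\<dots> = (LINT x:{?c..u}|lborel. f x)"
      unfolding set_lebesgue_integral_def
      using AE_lborel_singleton[of ?c] f(1)
      by (intro integral_cong_AE) (auto elim!: eventually_mono split: split_indicator)
    also have "\<dots> = integral {?c..u} f" by (rule set_borel_integral_eq_integral(2)[OF si])
    finally show ?thesis by simp
  qed simp
  have "((\<lambda>u. cdf ?M ?c + integral {?c..u} f) has_real_derivative 0 + f x) (at x within {?c..?d})"
    using e(1) by (intro DERIV_add DERIV_const integral_has_real_derivative[OF cf]) auto
  then have "((\<lambda>u. cdf ?M ?c + integral {?c..u} f) has_real_derivative f x) (at x within {?c..?d})"
    by simp
  then have "(cdf ?M has_real_derivative f x) (at x within {?c..?d})"
    by (rule has_field_derivative_transform_within[where d = 1]) (use e(1) in \<open>simp_all only: eq\<close>, auto)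
  moreover have "at x within {?c..?d} = at x" using e(1) by (intro at_within_Icc_at) auto
  ultimately show ?thesis by simp
qed

text \<open>Caratheodory's form F z - F (X y) = c z (z - X y), taken at z = X t, gives \<Phi> t -
  \<Phi> y = c (X t) (X t - X y). Dividing by t - y and by c (X t), which tends to r \<noteq> 0,
  avoids any division by X t - X y.\<close>

lemma implicit_DERIV:
  fixes X F \<Phi> :: "real \<Rightarrow> real"
  assumes F: "(F has_real_derivative r) (at (X y))" and r: "r \<noteq> 0"
    and \<Phi>: "(\<Phi> has_real_derivative g) (at y)" and X: "isCont X y" and eq: "\<And>t. F (X t) = \<Phi> t"
  shows "(X has_real_derivative g / r) (at y)"
proof -
  obtain c where c: "\<And>z. F z - F (X y) = c z * (z - X y)" "isCont c (X y)" "c (X y) = r"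
    using F by (auto simp: CARAT_DERIV)
  have cX: "((\<lambda>t. c (X t)) \<longlongrightarrow> r) (at y)"
    using isCont_o2[OF X c(2)] c(3) by (simp add: isCont_def)
  have "((\<lambda>t. ((\<Phi> t - \<Phi> y) / (t - y)) / c (X t)) \<longlongrightarrow> g / r) (at y)"
    using \<Phi> cX r by (intro tendsto_divide) (auto simp: has_field_derivative_iff)
  moreover have "\<forall>\<^sub>F t in at y. ((\<Phi> t - \<Phi> y) / (t - y)) / c (X t) = (X t - X y) / (t - y)"
    using tendsto_imp_eventually_ne[OF cX r]
  proof eventually_elim
    case (elim t)
    then show ?case using c(1)[of "X t"] by (simp add: eq)
  qed
  ultimately show ?thesis by (simp add: has_field_derivative_iff tendsto_cong)
qed

lemma one_plus_abs_le_square: "1 + \<bar>t :: real\<bar> \<le> 2 * (1 + t\<^sup>2)"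
  unfolding mult_2 by (intro add_mono abs_le_1_plus_square) simp

subsection \<open>The Beta laws\<close>

lemma beta_weight_nonneg: "0 \<le> beta_weight a b x"
  by (simp add: beta_weight_def)

lemma beta_weight_inside:
  "-1 < x \<Longrightarrow> x < 1 \<Longrightarrow> beta_weight a b x = (1 - x) powr a * (1 + x) powr b"
  by (simp add: beta_weight_def)

lemma beta_weight_pos: "-1 < x \<Longrightarrow> x < 1 \<Longrightarrow> 0 < beta_weight a b x"
  by (simp add: beta_weight_inside)

text \<open>At the endpoints one factor is \<open>0 powr _\<close>, which is 0 for every exponent,
  negative ones included. The weight therefore vanishes there even if it is unbounded
  nearby.\<close>

lemma beta_weight_outside: "x \<le> -1 \<or> 1 \<le> x \<Longrightarrow> beta_weight a b x = 0"
  by (cases "x = 1 \<or> x = -1") (auto simp: beta_weight_def)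

lemma beta_weight_measurable [measurable]: "beta_weight a b \<in> borel_measurable borel"
  unfolding beta_weight_def by measurable

text \<open>The substitution t = (1 + x)/2 turns the weight into a constant multiple of Euler's
  integrand. It sends 1 + x to t, which is why b belongs to the first argument of
  \<open>Beta\<close>.\<close>

lemma beta_weight_integrable:
  assumes "a > -1" "b > -1"
  shows "integrable lborel (beta_weight a b)"
proof -
  let ?f = "\<lambda>t::real. t powr b * (1 - t) powr a"
  have m: "(\<lambda>t. indicator {0..1} t * ?f t) \<in> borel_measurable borel" by measurable
  have "(?f has_integral Beta (b + 1) (a + 1)) {0..1}"
    using has_integral_Beta_real[of "b + 1" "a + 1"] assms by simp
  moreover have "(\<lambda>t. indicator {0..1} t * ?f t) = (\<lambda>t. if t \<in> {0..1} then ?f t else 0)"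
    by (auto simp: fun_eq_iff indicator_def)
  ultimately have "((\<lambda>t. indicator {0..1} t * ?f t) has_integral Beta (b + 1) (a + 1)) UNIV"
    by (simp only: has_integral_restrict_UNIV)
  then have "integrable lborel (\<lambda>t. indicator {0..1} t * ?f t)"
    using m by (intro integrableI_nonneg)
      (auto simp: nn_integral_has_integral_lborel[where I = "Beta (b + 1) (a + 1)"])
  then have "integrable lborel (\<lambda>x. indicator {0..1} (1/2 + 1/2 * x) * ?f (1/2 + 1/2 * x))"
    by (rule lborel_integrable_real_affine) simp
  moreover have "indicator {0..1} (1/2 + 1/2 * x) * ?f (1/2 + 1/2 * x) =
      (1/2) powr a * (1/2) powr b * beta_weight a b x" for x :: real
  proof (cases "-1 \<le> x \<and> x \<le> 1")
    case True
    have e: "1/2 + 1/2 * x = 1/2 * (1 + x)" "1 - (1/2 + 1/2 * x) = 1/2 * (1 - x)" by auto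
    have p: "(1/2 * (1 + x)) powr b = (1/2) powr b * (1 + x) powr b"
      "(1/2 * (1 - x)) powr a = (1/2) powr a * (1 - x) powr a"
      using True powr_mult[of "1/2" "1 + x" b] powr_mult[of "1/2" "1 - x" a] by auto
    have "?f (1/2 + 1/2 * x) = (1/2) powr b * (1 + x) powr b * ((1/2) powr a * (1 - x) powr a)"
      unfolding e(2) unfolding e(1) p ..
    then show ?thesis using True by (simp add: beta_weight_def)
  qed (auto simp: beta_weight_def indicator_def)
  ultimately show ?thesis by simp
qed

definition beta_density :: "real \<Rightarrow> real \<Rightarrow> real \<Rightarrow> real" where
  "beta_density a b x = beta_weight a b x / (\<integral>u. beta_weight a b u \<partial>lborel)"

lemma beta_law_eq: "beta_law a b = density lborel (\<lambda>x. ennreal (beta_density a b x))"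
  by (simp add: beta_law_def beta_density_def)

lemma beta_weight_integral_pos:
  assumes "a > -1" "b > -1"
  shows "0 < (\<integral>u. beta_weight a b u \<partial>lborel)"
proof (rule ccontr)
  assume "\<not> ?thesis"
  then have "(\<integral>u. beta_weight a b u \<partial>lborel) = 0"
    by (metis Bochner_Integration.integral_nonneg beta_weight_nonneg order_le_less)
  then have "AE x in lborel. beta_weight a b x = 0"
    by (subst (asm) integral_nonneg_eq_0_iff_AE) (auto simp: beta_weight_integrable assms beta_weight_nonneg)
  then have "AE x in lborel. x \<notin> {-1<..<1::real}"
    by eventually_elim (metis beta_weight_pos greaterThanLessThan_iff less_irrefl)
  then have "emeasure lborel {-1<..<1::real} = 0"
    by (subst (asm) AE_iff_measurable[of "{-1<..<1}"]) auto
  then show False by simp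
qed

lemma beta_density_nonneg: "0 \<le> beta_density a b x"
  by (simp add: beta_density_def beta_weight_nonneg)

lemma beta_density_integrable:
  "a > -1 \<Longrightarrow> b > -1 \<Longrightarrow> integrable lborel (beta_density a b)"
  unfolding beta_density_def by (simp add: beta_weight_integrable)

lemma prob_space_beta_law:
  assumes "a > -1" "b > -1"
  shows "prob_space (beta_law a b)"
proof
  have "emeasure (beta_law a b) (space (beta_law a b)) = (\<integral>\<^sup>+x. ennreal (beta_density a b x) \<partial>lborel)"
    using borel_measurable_integrable[OF beta_density_integrable[OF assms]]
    unfolding beta_law_eq by (subst emeasure_density) auto
  also have "\<dots> = ennreal (\<integral>x. beta_density a b x \<partial>lborel)"
    by (intro nn_integral_eq_integral beta_density_integrable assms AE_I2 beta_density_nonneg)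
  also have "(\<integral>x. beta_density a b x \<partial>lborel) = 1"
    using beta_weight_integral_pos[OF assms] by (simp add: beta_density_def)
  finally show "emeasure (beta_law a b) (space (beta_law a b)) = 1" by simp
qed

lemma cdf_beta_law_DERIV:
  assumes ab: "a > -1" "b > -1" and x: "x \<in> {-1<..<1}"
  shows "(cdf (beta_law a b) has_real_derivative beta_density a b x) (at x)"
  unfolding beta_law_eq
proof (rule cdf_density_DERIV)
  have "continuous_on {-1<..<1} (\<lambda>x::real. (1 - x) powr a * (1 + x) powr b / (\<integral>u. beta_weight a b u \<partial>lborel))"
    using beta_weight_integral_pos[OF ab] by (intro continuous_intros) auto
  then show "continuous_on {-1<..<1} (beta_density a b)"
    by (rule continuous_on_cong[THEN iffD1, rotated 2]) (auto simp: beta_density_def beta_weight_inside)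
qed (use x prob_space_beta_law[OF ab] beta_density_integrable[OF ab]
    in \<open>auto simp: beta_density_nonneg beta_law_eq\<close>)

lemma cdf_beta_law_boundary:
  assumes ab: "a > -1" "b > -1"
  shows "x \<le> -1 \<Longrightarrow> cdf (beta_law a b) x = 0" and "1 \<le> x \<Longrightarrow> cdf (beta_law a b) x = 1"
proof -
  have c: "cdf (beta_law a b) x = (LINT u:{..x}|lborel. beta_density a b u)" for x
    unfolding cdf_def beta_law_eq
    by (intro measure_density_lborel beta_density_integrable ab beta_density_nonneg) simp
  show "cdf (beta_law a b) x = 0" if "x \<le> -1"
  proof -
    have "(\<integral>u. indicator {..x} u * beta_density a b u \<partial>lborel) = integral\<^sup>L lborel (\<lambda>u::real. 0)"
      using that by (intro Bochner_Integration.integral_cong)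
        (auto simp: indicator_def beta_density_def beta_weight_outside)
    then show ?thesis by (simp add: c set_lebesgue_integral_def)
  qed
  show "cdf (beta_law a b) x = 1" if "1 \<le> x"
  proof -
    have "(\<integral>u. indicator {..x} u * beta_density a b u \<partial>lborel) = integral\<^sup>L lborel (beta_density a b)"
      using that by (intro Bochner_Integration.integral_cong)
        (auto simp: indicator_def beta_density_def beta_weight_outside)
    then show ?thesis
      using beta_weight_integral_pos[OF ab] by (simp add: c set_lebesgue_integral_def beta_density_def[abs_def])
  qed
qed

lemma isCont_cdf_beta_law:
  assumes ab: "a > -1" "b > -1"
  shows "isCont (cdf (beta_law a b)) x"
proof -
  interpret real_distribution "beta_law a b"
    using real_distribution_density prob_space_beta_law[OF ab] by (simp add: beta_law_eq)
  have "measure (beta_law a b) {x} = (LINT u:{x}|lborel. beta_density a b u)"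
    unfolding beta_law_eq by (intro measure_density_lborel beta_density_integrable ab beta_density_nonneg) simp
  also have "\<dots> = 0"
    unfolding set_lebesgue_integral_def
  proof (rule integral_eq_zero_AE)
    show "AE u in lborel. indicator {x} u *\<^sub>R beta_density a b u = 0"
      using AE_lborel_singleton[of x] by eventually_elim simp
  qed
  finally show ?thesis by (simp add: isCont_cdf)
qed

section \<open>The Gaussian distribution function\<close>

lemma cdf_gauss_DERIV: "(cdf gauss has_real_derivative std_normal_density t) (at t)"
proof (rule cdf_density_DERIV[where I = UNIV])
  show "continuous_on UNIV std_normal_density"
    by (rule DERIV_continuous_on, rule has_field_derivative_at_within, rule std_normal_density_DERIV)
  show "integrable lborel std_normal_density" by (rule integrable_normal_density) simp
qed (auto intro: prob_space_gauss)

interpretation gauss_real: real_distribution gauss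
  by (rule real_distribution_density) (rule prob_space_gauss)

lemma cdf_gauss_strict_mono: "s < t \<Longrightarrow> cdf gauss s < cdf gauss t"
  by (rule DERIV_pos_imp_increasing)
     (auto intro!: exI cdf_gauss_DERIV simp: normal_density_pos)

lemma cdf_gauss_bounds: "0 < cdf gauss t" "cdf gauss t < 1"
proof -
  show "0 < cdf gauss t"
    using cdf_gauss_strict_mono[of "t - 1" t] gauss_real.cdf_nonneg[of "t - 1"] by linarith
  show "cdf gauss t < 1"
    using cdf_gauss_strict_mono[of t "t + 1"] gauss_real.cdf_bounded_prob[of "t + 1"] by linarith
qed

lemma cdf_gauss_surj:
  assumes "0 < p" "p < 1"
  obtains t where "cdf gauss t = p"
proof -
  have "\<forall>\<^sub>F t in at_bot. cdf gauss t < p"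
    using gauss_real.cdf_lim_at_bot assms(1) by (rule order_tendstoD)
  then obtain s where s: "cdf gauss s < p" by (metis eventually_at_bot_linorder order_refl)
  have "\<forall>\<^sub>F t in at_top. p < cdf gauss t"
    using gauss_real.cdf_lim_at_top_prob assms(2) by (rule order_tendstoD)
  then obtain u where u: "p < cdf gauss u" by (metis eventually_at_top_linorder order_refl)
  have "s \<le> u" using s u gauss_real.cdf_nondecreasing[of u s] by linarith
  then have "\<exists>t. s \<le> t \<and> t \<le> u \<and> cdf gauss t = p"
    using s u cdf_gauss_DERIV by (intro IVT) (auto intro: DERIV_isCont)
  then show thesis using that by blast
qed

subsection \<open>Monotone transport from the Gaussian to the Beta law\<close>

text \<open>The length \<delta> = 1/(1+y) is the scale on which the density changes by a bounded
  factor: (y + \<delta>)^2 \<le> y^2 + 3, so the density stays above exp(-3/2) times its value at y.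
  Up to a constant this is the lower Mills bound for the tail.\<close>

lemma gaussian_increment:
  assumes \<Phi>: "\<And>t. (\<Phi> has_real_derivative std_normal_density t) (at t)" and y: "y \<ge> 0"
  shows "std_normal_density y * exp (-3/2) / (1 + y) \<le> \<Phi> (y + 1 / (1 + y)) - \<Phi> y"
proof -
  let ?\<delta> = "1 / (1 + y)" and ?c = "std_normal_density y * exp (-3/2)"
  have \<delta>: "0 \<le> ?\<delta>" "?\<delta> \<le> 1" "2 * y * ?\<delta> \<le> 2" using y by (auto simp: field_simps)
  have "\<Phi> y - ?c * y \<le> \<Phi> (y + ?\<delta>) - ?c * (y + ?\<delta>)"
  proof (rule DERIV_nonneg_imp_nondecreasing[where f = "\<lambda>u. \<Phi> u - ?c * u"])
    fix u assume u: "y \<le> u" "u \<le> y + ?\<delta>"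
    have "u\<^sup>2 \<le> (y + ?\<delta>)\<^sup>2" using u y by (intro power_mono) auto
    also have "\<dots> = y\<^sup>2 + 2 * y * ?\<delta> + ?\<delta>\<^sup>2" by (simp add: power2_sum)
    also have "\<dots> \<le> y\<^sup>2 + 2 + 1" using \<delta> power_le_one[of ?\<delta> 2] by linarith
    finally have "exp (- y\<^sup>2 / 2 + -3/2) \<le> exp (- u\<^sup>2 / 2)" by simp
    then have "?c \<le> std_normal_density u"
      unfolding std_normal_density_def exp_add by (simp add: divide_right_mono)
    moreover have "((\<lambda>u. \<Phi> u - ?c * u) has_real_derivative std_normal_density u - ?c) (at u)"
      by (rule derivative_eq_intros \<Phi> refl | simp)+
    ultimately show "\<exists>d. ((\<lambda>u. \<Phi> u - ?c * u) has_real_derivative d) (at u) \<and> 0 \<le> d"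
      by (intro exI[of _ "std_normal_density u - ?c"]) simp
  qed (use \<delta> in simp)
  then show ?thesis by (simp add: algebra_simps)
qed

text \<open>
  Stated for an arbitrary pair \<open>F, \<Phi>\<close> and not only for the two distribution functions, because the
  left tail is obtained by applying it to \<open>-F(-x)\<close> and \<open>-\<Phi>(-t)\<close>.
\<close>
lemma transport_right_tail:
  fixes F \<Phi> X :: "real \<Rightarrow> real"
  assumes c: "c \<ge> 0" and a: "a > -1" and b: "b > -1"
    and F: "\<And>x. x \<in> {-1<..<1} \<Longrightarrow>
      (F has_real_derivative c * ((1 - x) powr a * (1 + x) powr b)) (at x)"
    and \<Phi>: "\<And>t. (\<Phi> has_real_derivative std_normal_density t) (at t)"
    and X: "\<And>t. X t \<in> {-1<..<1}" "\<And>t. F (X t) = \<Phi> t" "mono X"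
  shows "\<exists>C. \<forall>y\<ge>0. std_normal_density y *
    ((1 - X y) powr (-(a + 1)) * (1 + X y) powr (-(b + 1))) \<le> C * (1 + y)"
proof -
  \<comment> \<open>On [X 0, 1) the factor (1 + u)^b is monotone, increasing or decreasing with the
    sign of b, and M covers both cases. K is then what integrating c M (1 - u)^a produces.\<close>
  define M where "M = max ((1 + X 0) powr b) (2 powr b)"
  define K where "K = c * M / (a + 1)"
  have K: "K \<ge> 0" unfolding K_def M_def using c a
    by (auto intro!: divide_nonneg_pos mult_nonneg_nonneg simp: le_max_iff_disj)
  have M: "(1 + u) powr b \<le> M" if "X 0 \<le> u" "u < 1" for u
  proof (cases "b \<ge> 0")
    case True
    then have "(1 + u) powr b \<le> 2 powr b" using that X(1)[of 0] by (intro powr_mono2) auto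
    then show ?thesis by (simp add: M_def)
  next
    case False
    then have "(1 + u) powr b \<le> (1 + X 0) powr b" using that X(1)[of 0] by (intro powr_mono2') auto
    then show ?thesis by (simp add: M_def)
  qed
  \<comment> \<open>The integral estimate is obtained without integrating: F + K (1 - u)^(a+1) has
    nonpositive derivative by the choice of K.\<close>
  have inc: "F z - F x \<le> K * (1 - x) powr (a + 1)" if xz: "X 0 \<le> x" "x \<le> z" "z < 1" for x z
  proof -
    let ?h = "\<lambda>u. F u + K * (1 - u) powr (a + 1)"
    have "?h z \<le> ?h x"
    proof (rule DERIV_nonpos_imp_nonincreasing[OF xz(2)])
      fix u assume u: "x \<le> u" "u \<le> z"
      then have u1: "u \<in> {-1<..<1}" "X 0 \<le> u" "u < 1" using xz X(1)[of 0] by auto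
      have "((\<lambda>u. (1 - u) powr (a + 1)) has_real_derivative - ((a + 1) * (1 - u) powr a)) (at u)"
        using u1 by (auto intro!: derivative_eq_intros)
      then have d: "(?h has_real_derivative c * ((1 - u) powr a * (1 + u) powr b) +
          K * - ((a + 1) * (1 - u) powr a)) (at u)"
        by (intro DERIV_add F u1 DERIV_cmult)
      have "c * ((1 - u) powr a * (1 + u) powr b) \<le> c * ((1 - u) powr a * M)"
        using M[OF u1(2,3)] c by (intro mult_left_mono) auto
      also have "\<dots> = K * ((a + 1) * (1 - u) powr a)" using a by (simp add: K_def)
      finally show "\<exists>d. (?h has_real_derivative d) (at u) \<and> d \<le> 0" using d by fastforce
    qed
    moreover have "0 \<le> K * (1 - z) powr (a + 1)" using K by simp
    ultimately show ?thesis by simp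
  qed
  have "std_normal_density y * ((1 - X y) powr (-(a + 1)) * (1 + X y) powr (-(b + 1)))
      \<le> (K * exp (3/2) * (1 + X 0) powr (-(b + 1))) * (1 + y)" if y: "y \<ge> 0" for y
  proof -
    let ?u = "(1 - X y) powr (a + 1)"
    have u: "?u > 0" using X(1)[of y] by simp
    have X0: "X 0 \<le> X y" "X y \<le> X (y + 1 / (1 + y))" using X(3) y by (auto simp: mono_def)
    have "std_normal_density y * exp (-3/2) / (1 + y) \<le> F (X (y + 1 / (1 + y))) - F (X y)"
      using gaussian_increment[OF \<Phi> y] by (simp add: X(2))
    also have "\<dots> \<le> K * ?u" using X0 X(1) by (intro inc) auto
    finally have "std_normal_density y * exp (-3/2) \<le> K * ?u * (1 + y)"
      using y by (subst (asm) pos_divide_le_eq) auto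
    then have "std_normal_density y * exp (-3/2) * exp (3/2) \<le> K * ?u * (1 + y) * exp (3/2)"
      by (rule mult_right_mono) simp
    then have "std_normal_density y \<le> K * ?u * (1 + y) * exp (3/2)"
      by (simp add: mult.assoc flip: exp_add)
    then have 1: "std_normal_density y * (1 - X y) powr (-(a + 1)) \<le> K * exp (3/2) * (1 + y)"
      unfolding powr_minus[of "1 - X y" "a + 1"] using u by (simp add: divide_simps mult_ac)
    \<comment> \<open>For y \<ge> 0 the other endpoint is out of reach: X y stays above X 0 and the
      exponent is negative.\<close>
    have 2: "(1 + X y) powr (-(b + 1)) \<le> (1 + X 0) powr (-(b + 1))"
      using b X0 X(1)[of 0] by (intro powr_mono2') auto
    show ?thesis
      using mult_mono[OF 1 2] K y by (simp add: mult_ac)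
  qed
  then show ?thesis by blast
qed

text \<open>Only a pointwise solution of the quantile equation is assumed. The open range keeps
  \<open>X\<close> where the Beta density is positive and its distribution function differentiable;
  monotonicity, continuity and measurability of \<open>X\<close> are consequences.\<close>

locale beta_transport =
  fixes a b :: real and X :: "real \<Rightarrow> real"
  assumes a: "a > -1" and b: "b > -1"
    and range: "\<And>t. X t \<in> {-1<..<1}"
    and cdf: "\<And>t. cdf (beta_law a b) (X t) = cdf gauss t"
begin

sublocale beta: real_distribution "beta_law a b"
  using real_distribution_density prob_space_beta_law[OF a b] by (simp add: beta_law_eq)

definition Z :: real where "Z = (\<integral>u. beta_weight a b u \<partial>lborel)"

lemma Z_pos: "Z > 0"
  unfolding Z_def by (rule beta_weight_integral_pos[OF a b])

lemma beta_density_X: "beta_density a b (X t) = (1 - X t) powr a * (1 + X t) powr b / Z"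
  using range[of t] by (simp add: beta_density_def beta_weight_inside Z_def)

lemma beta_density_X_pos: "beta_density a b (X t) > 0"
  using range[of t] Z_pos by (simp add: beta_density_X)

lemma X_strict_mono: "strict_mono X"
proof (rule strict_monoI)
  fix s t :: real assume "s < t"
  then have "cdf (beta_law a b) (X s) < cdf (beta_law a b) (X t)"
    using cdf_gauss_strict_mono by (simp add: cdf)
  then show "X s < X t" using beta.cdf_nondecreasing[of "X t" "X s"] by linarith
qed

lemma cdf_beta_strict_mono:
  assumes "x \<in> {-1<..<1}" "z \<in> {-1<..<1}" "x < z"
  shows "cdf (beta_law a b) x < cdf (beta_law a b) z"
proof (rule DERIV_pos_imp_increasing[OF assms(3)])
  fix u assume u: "x \<le> u" "u \<le> z"
  then have i: "u \<in> {-1<..<1}" using assms by auto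
  then have "beta_density a b u > 0"
    using Z_pos beta_weight_pos[of u a b] by (auto simp: beta_density_def Z_def)
  then show "\<exists>d. (cdf (beta_law a b) has_real_derivative d) (at u) \<and> 0 < d"
    by (intro exI[of _ "beta_density a b u"] conjI cdf_beta_law_DERIV[OF a b i])
qed

text \<open>Continuity of the Gaussian distribution function is pulled back through the Beta one. A
  level strictly between -1 and 1 is separated from X t by strict monotonicity; for the other levels
  the range of \<open>X\<close> decides.\<close>

lemma X_isCont: "isCont X t"
proof -
  have \<Phi>: "(cdf gauss \<longlongrightarrow> cdf (beta_law a b) (X t)) (at t)"
    using DERIV_isCont[OF cdf_gauss_DERIV, of t] unfolding isCont_def cdf .
  have "(X \<longlongrightarrow> X t) (at t)"
  proof (rule order_tendstoI)
    fix l assume l: "l < X t"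
    show "\<forall>\<^sub>F s in at t. l < X s"
    proof (cases "l \<le> -1")
      case True
      then have "l < X s" for s using range[of s] by simp
      then show ?thesis by simp
    next
      case False
      then have "cdf (beta_law a b) l < cdf (beta_law a b) (X t)"
        using l range[of t] by (intro cdf_beta_strict_mono) auto
      with \<Phi> have "\<forall>\<^sub>F s in at t. cdf (beta_law a b) l < cdf gauss s" by (rule order_tendstoD)
      then show ?thesis
      proof eventually_elim
        case (elim s)
        then show ?case using beta.cdf_nondecreasing[of "X s" l] cdf[of s] by linarith
      qed
    qed
  next
    fix l assume l: "X t < l"
    show "\<forall>\<^sub>F s in at t. X s < l"
    proof (cases "1 \<le> l")
      case True
      then have "X s < l" for s using range[of s] by simp
      then show ?thesis by simp
    next
      case False
      then have "cdf (beta_law a b) (X t) < cdf (beta_law a b) l"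
        using l range[of t] by (intro cdf_beta_strict_mono) auto
      with \<Phi> have "\<forall>\<^sub>F s in at t. cdf gauss s < cdf (beta_law a b) l" by (rule order_tendstoD)
      then show ?thesis
      proof eventually_elim
        case (elim s)
        then show ?case using beta.cdf_nondecreasing[of l "X s"] cdf[of s] by linarith
      qed
    qed
  qed
  then show ?thesis by (simp add: isCont_def)
qed

lemma X_DERIV_density:
  "(X has_real_derivative std_normal_density t / beta_density a b (X t)) (at t)"
  using beta_density_X_pos[of t]
  by (intro implicit_DERIV[OF cdf_beta_law_DERIV[OF a b range] _ cdf_gauss_DERIV X_isCont cdf]) simp

text \<open>Written as a product so that it is \<open>Z\<close> times the very quantity bounded in
  \<open>transport_right_tail\<close>, with a logarithmic derivative that can be read off.\<close>

definition P :: "real \<Rightarrow> real" where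
  "P t = Z * (std_normal_density t * ((1 - X t) powr (-(a + 1)) * (1 + X t) powr (-(b + 1))))"

lemma X_DERIV: "(X has_real_derivative (1 - X t * X t) * P t) (at t)"
proof -
  let ?u = "1 - X t" and ?v = "1 + X t"
  have uv: "?u > 0" "?v > 0" using range[of t] by auto
  have "(1 - X t * X t) * P t = Z * std_normal_density t *
      ((?u * ?u powr (-(a + 1))) * (?v * ?v powr (-(b + 1))))"
    by (simp add: P_def algebra_simps)
  also have "?u * ?u powr (-(a + 1)) = ?u powr (-a)"
    using uv by (subst powr_mult_base) auto
  also have "?v * ?v powr (-(b + 1)) = ?v powr (-b)"
    using uv by (subst powr_mult_base) auto
  finally have "(1 - X t * X t) * P t = std_normal_density t / beta_density a b (X t)"
    using uv Z_pos by (simp add: beta_density_X powr_minus field_simps)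
  then show ?thesis using X_DERIV_density by simp
qed

lemma P_DERIV:
  "(P has_real_derivative P t * (- t + (a + 1) * (1 + X t) * P t - (b + 1) * (1 - X t) * P t)) (at t)"
proof -
  let ?u = "1 - X t" and ?v = "1 + X t" and ?A = "-(a + 1)" and ?B = "-(b + 1)"
  let ?X' = "(1 - X t * X t) * P t"
  have uv: "?u > 0" "?v > 0" using range[of t] by auto
  have du: "((\<lambda>t. (1 - X t) powr ?A) has_real_derivative ?A * ?u powr (?A - 1) * (0 - ?X')) (at t)"
    using DERIV_fun_powr[OF DERIV_diff[OF DERIV_const X_DERIV] uv(1), of ?A] by simp
  have dv: "((\<lambda>t. (1 + X t) powr ?B) has_real_derivative ?B * ?v powr (?B - 1) * (0 + ?X')) (at t)"
    using DERIV_fun_powr[OF DERIV_add[OF DERIV_const X_DERIV] uv(2), of ?B] by simp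
  have pu: "?u powr (?A - 1) = ?u powr ?A / ?u" and pv: "?v powr (?B - 1) = ?v powr ?B / ?v"
    using uv by (simp_all only: powr_diff powr_one less_imp_le)
  \<comment> \<open>This is the cancellation of the poles, freed from powers: u and v stand for 1 -
    X and 1 + X, p and q for their powers, w for P, g for the Gaussian density. The factor u v of X'
    removes the denominators.\<close>
  have alg: "z * ((- t * g) * (p * q) + ((A * (p / u) * (0 - u * v * w)) * q +
      (B * (q / v) * (0 + u * v * w)) * p) * g) = (z * (g * (p * q))) * (- t - A * v * w + B * u * w)"
    if "u \<noteq> 0" "v \<noteq> 0" for z g p q A B u v w :: real
    using that by (simp add: field_simps)
  have X': "?X' = ?u * ?v * P t" by (simp add: algebra_simps)
  have "(P has_real_derivative Z * ((- t * std_normal_density t) * (?u powr ?A * ?v powr ?B) +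
      ((?A * ?u powr (?A - 1) * (0 - ?X')) * ?v powr ?B + (?B * ?v powr (?B - 1) * (0 + ?X')) * ?u powr ?A) *
        std_normal_density t)) (at t)"
  proof -
    have "P = (\<lambda>t. Z * (std_normal_density t * ((1 - X t) powr ?A * (1 + X t) powr ?B)))"
      by (simp add: fun_eq_iff P_def)
    then show ?thesis
      by (rule ssubst[where P = "\<lambda>f. (f has_real_derivative _) _"])
         (intro DERIV_cmult DERIV_mult std_normal_density_DERIV du dv)
  qed
  also have "Z * ((- t * std_normal_density t) * (?u powr ?A * ?v powr ?B) +
      ((?A * ?u powr (?A - 1) * (0 - ?X')) * ?v powr ?B + (?B * ?v powr (?B - 1) * (0 + ?X')) * ?u powr ?A) *
        std_normal_density t) =
     (Z * (std_normal_density t * (?u powr ?A * ?v powr ?B))) * (- t - ?A * ?v * P t + ?B * ?u * P t)"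
    unfolding pu pv X' using uv by (intro alg) auto
  also have "\<dots> = P t * (- t + (a + 1) * ?v * P t - (b + 1) * ?u * P t)"
    unfolding P_def[of t, symmetric] by (simp add: algebra_simps)
  finally show ?thesis .
qed

lemma P_nonneg: "0 \<le> P t"
  using Z_pos by (simp add: P_def normal_density_nonneg)

lemma P_growth: "\<exists>C m. \<forall>t. \<bar>P t\<bar> \<le> C * (1 + t\<^sup>2) ^ m"
proof -
  have F: "(cdf (beta_law a b) has_real_derivative 1 / Z * ((1 - x) powr a * (1 + x) powr b)) (at x)"
    if "x \<in> {-1<..<1}" for x
    using cdf_beta_law_DERIV[OF a b that] that by (simp add: beta_density_def beta_weight_inside Z_def)
  obtain C where C: "\<And>y. y \<ge> 0 \<Longrightarrow> std_normal_density y *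
      ((1 - X y) powr (-(a + 1)) * (1 + X y) powr (-(b + 1))) \<le> C * (1 + y)"
    using transport_right_tail[OF _ a b F cdf_gauss_DERIV range cdf strict_mono_mono[OF X_strict_mono]]
      Z_pos by fastforce
  \<comment> \<open>The reflection exchanges the endpoints, so a and b trade places. At y = -t the
    bounded product is the original one at t, the Gaussian density being even.\<close>
  let ?F = "\<lambda>x. - cdf (beta_law a b) (- x)" and ?X = "\<lambda>t. - X (- t)" and ?\<Phi> = "\<lambda>t. - cdf gauss (- t)"
  obtain D where D: "\<And>y. y \<ge> 0 \<Longrightarrow> std_normal_density y *
      ((1 - ?X y) powr (-(b + 1)) * (1 + ?X y) powr (-(a + 1))) \<le> D * (1 + y)"
  proof -
    have "\<exists>C. \<forall>y\<ge>0. std_normal_density y *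
        ((1 - ?X y) powr (-(b + 1)) * (1 + ?X y) powr (-(a + 1))) \<le> C * (1 + y)"
    proof (rule transport_right_tail[where F = ?F and \<Phi> = ?\<Phi> and c = "1 / Z"])
      show "(?F has_real_derivative 1 / Z * ((1 - x) powr b * (1 + x) powr a)) (at x)"
        if "x \<in> {-1<..<1}" for x
      proof -
        have "- x \<in> {-1<..<1}" using that by auto
        from DERIV_minus[OF DERIV_chain'[OF DERIV_minus[OF DERIV_ident] F[OF this]]]
        show ?thesis by (simp add: mult_ac)
      qed
      show "(?\<Phi> has_real_derivative std_normal_density t) (at t)" for t
        using DERIV_minus[OF DERIV_chain'[OF DERIV_minus[OF DERIV_ident] cdf_gauss_DERIV]]
        by (simp add: std_normal_density_def)
      show "mono ?X" using strict_mono_mono[OF X_strict_mono] by (auto simp: mono_def)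
    qed (use a b Z_pos range cdf in auto)
    then show thesis using that by blast
  qed
  have "\<bar>P t\<bar> \<le> (2 * Z * (\<bar>C\<bar> + \<bar>D\<bar>)) * (1 + t\<^sup>2) ^ 1" for t
  proof -
    let ?p = "std_normal_density t * ((1 - X t) powr (-(a + 1)) * (1 + X t) powr (-(b + 1)))"
    have sq: "1 + \<bar>t\<bar> \<le> 2 * (1 + t\<^sup>2)"
      by (rule one_plus_abs_le_square)
    have "?p \<le> (\<bar>C\<bar> + \<bar>D\<bar>) * (1 + \<bar>t\<bar>)"
    proof (cases "t \<ge> 0")
      case True
      have "?p \<le> C * (1 + t)" using C[OF True] .
      also have "\<dots> \<le> (\<bar>C\<bar> + \<bar>D\<bar>) * (1 + \<bar>t\<bar>)" using True by (intro mult_mono) auto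
      finally show ?thesis .
    next
      case False
      then have "?p \<le> D * (1 + (- t))"
        using D[of "- t"] by (simp add: std_normal_density_def mult_ac)
      also have "\<dots> \<le> (\<bar>C\<bar> + \<bar>D\<bar>) * (1 + \<bar>t\<bar>)" using False by (intro mult_mono) auto
      finally show ?thesis .
    qed
    also have "\<dots> \<le> (\<bar>C\<bar> + \<bar>D\<bar>) * (2 * (1 + t\<^sup>2))" using sq by (intro mult_left_mono) auto
    finally have "Z * ?p \<le> Z * ((\<bar>C\<bar> + \<bar>D\<bar>) * (2 * (1 + t\<^sup>2)))"
      using Z_pos by (intro mult_left_mono) auto
    then have "\<bar>P t\<bar> \<le> Z * ((\<bar>C\<bar> + \<bar>D\<bar>) * (2 * (1 + t\<^sup>2)))"
      using P_nonneg[of t] unfolding P_def[of t, symmetric] by simp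
    also have "\<dots> = (2 * Z * (\<bar>C\<bar> + \<bar>D\<bar>)) * (1 + t\<^sup>2) ^ 1" by (simp add: algebra_simps)
    finally show ?thesis .
  qed
  then show ?thesis by blast
qed

lemma X_measurable [measurable]: "X \<in> borel_measurable borel"
  using X_isCont by (intro borel_measurable_continuous_onI continuous_at_imp_continuous_on) auto

lemma distr_gauss_X: "distr gauss borel X = beta_law a b"
proof (rule cdf_unique)
  show "real_distribution (distr gauss borel X)"
    by (intro gauss.real_distribution_distr) simp
  show "real_distribution (beta_law a b)" ..
  show "cdf (distr gauss borel X) = cdf (beta_law a b)"
  proof
    fix x
    have m: "cdf (distr gauss borel X) x = measure gauss {t. X t \<le> x}"
      unfolding cdf_def by (subst measure_distr) (auto intro!: arg_cong[where f = "measure gauss"])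
    consider "x \<le> -1" | "1 \<le> x" | "x \<in> {-1<..<1}" by fastforce
    then show "cdf (distr gauss borel X) x = cdf (beta_law a b) x"
    proof cases
      case 1
      then have "{t. X t \<le> x} = {}" using range by (auto simp: not_le intro: le_less_trans)
      then show ?thesis using cdf_beta_law_boundary(1)[OF a b 1] m by simp
    next
      case 2
      then have "{t. X t \<le> x} = space gauss" using range by (auto intro: less_imp_le less_le_trans)
      then show ?thesis using cdf_beta_law_boundary(2)[OF a b 2] m gauss.prob_space by simp
    next
      case 3
      \<comment> \<open>Strictness comes from comparing x with the midpoint between -1 and x, and
        below with the midpoint between x and 1.\<close>
      have "0 < cdf (beta_law a b) x"
        using cdf_beta_strict_mono[of "(x - 1) / 2" x] beta.cdf_nonneg[of "(x - 1) / 2"] 3 by force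
      moreover have "cdf (beta_law a b) x < 1"
        using cdf_beta_strict_mono[of x "(x + 1) / 2"] beta.cdf_bounded_prob[of "(x + 1) / 2"] 3 by force
      ultimately obtain t where t: "cdf gauss t = cdf (beta_law a b) x" by (rule cdf_gauss_surj)
      have "X t = x"
      proof (rule ccontr)
        assume "X t \<noteq> x"
        then show False
          using cdf_beta_strict_mono[OF range[of t] 3] cdf_beta_strict_mono[OF 3 range[of t]] t cdf[of t]
          by linarith
      qed
      then have "{s. X s \<le> x} = {..t}" using strict_mono_less_eq[OF X_strict_mono] by auto
      then show ?thesis using m t by (simp add: cdf_def)
    qed
  qed
qed

section \<open>The differential algebra of the transport\<close>

definition transport_algebra :: "(real \<Rightarrow> real) set" where
  "transport_algebra = generated_algebra {\<lambda>t. t, X, P}"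

lemma gaussian_algebra_transport: "gaussian_algebra transport_algebra"
  unfolding transport_algebra_def
proof (rule gaussian_algebra_generated)
  let ?G = "generated_algebra {\<lambda>t. t, X, P}"
  note I = generated_algebra.add generated_algebra.mult generated_algebra.const
  have gen: "(\<lambda>t. t) \<in> ?G" "X \<in> ?G" "P \<in> ?G" by (auto intro: generated_algebra.generator)
  fix f assume "f \<in> {\<lambda>t. t, X, P}"
  then consider "f = (\<lambda>t. t)" | "f = X" | "f = P" by blast
  then show "\<exists>f'\<in>?G. \<forall>t. (f has_real_derivative f' t) (at t)"
  proof cases
    case 1
    then show ?thesis by (intro bexI[of _ "\<lambda>t. 1"]) (auto intro: I)
  next
    case 2
    \<comment> \<open>Differences are spelled as sums with a factor -1, to match the constructors of
      the generated algebra; likewise for the derivative of \<open>P\<close>.\<close>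
    have "(\<lambda>t. (1 + (-1) * (X t * X t)) * P t) \<in> ?G" by (intro I gen)
    then show ?thesis using X_DERIV 2 by (intro bexI[of _ "\<lambda>t. (1 + (-1) * (X t * X t)) * P t"]) auto
  next
    case 3
    let ?f' = "\<lambda>t. P t * ((-1) * t + (a + 1) * (1 + X t) * P t + (-1) * ((b + 1) * (1 + (-1) * X t) * P t))"
    have "?f' \<in> ?G" by (intro I gen)
    then show ?thesis using P_DERIV 3 by (intro bexI[of _ ?f']) auto
  qed
next
  fix f assume "f \<in> {\<lambda>t. t, X, P}"
  then consider "f = (\<lambda>t. t)" | "f = X" | "f = P" by blast
  then show "\<exists>C m. \<forall>t. \<bar>f t\<bar> \<le> C * (1 + t\<^sup>2) ^ m"
  proof cases
    case 1
    have "\<bar>t\<bar> \<le> 1 * (1 + t\<^sup>2) ^ 1" for t :: real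
      using abs_le_1_plus_square[of t] by simp
    then show ?thesis using 1 by blast
  next
    case 2
    have "\<bar>X t\<bar> \<le> 1 * (1 + t\<^sup>2) ^ 0" for t using range[of t] by auto
    then show ?thesis using 2 by blast
  next
    case 3
    then show ?thesis using P_growth by simp
  qed
qed simp

sublocale gaussian_algebra transport_algebra
  by (rule gaussian_algebra_transport)

lemma X_mem: "X \<in> transport_algebra"
  unfolding transport_algebra_def by (intro generated_algebra.generator) simp

section \<open>Moments of the two densities\<close>

lemma deriv_X: "deriv X t = std_normal_density t / beta_density a b (X t)"
  by (rule DERIV_imp_deriv[OF X_DERIV_density])

text \<open>Since \<open>X\<close> has the Beta law, the integral is that of \<rho>^(1+s), which is
  up to a constant the Beta weight with both exponents multiplied by 1 + s. The hypotheses say that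
  this weight is again integrable.\<close>

lemma integrable_beta_density_power:
  assumes s: "a * (1 + s) > -1" "b * (1 + s) > -1"
  shows "integrable gauss (\<lambda>t. beta_density a b (X t) powr s)"
proof -
  have "integrable lborel (\<lambda>x. Z powr (-(1 + s)) * beta_weight (a * (1 + s)) (b * (1 + s)) x)"
    using beta_weight_integrable[OF s] by simp
  moreover have "Z powr (-(1 + s)) * beta_weight (a * (1 + s)) (b * (1 + s)) x =
      beta_density a b x * beta_density a b x powr s" for x
  proof (cases "x \<in> {-1<..<1}")
    case True
    then have pos: "beta_density a b x > 0"
      using Z_pos beta_weight_pos[of x a b] by (auto simp: beta_density_def Z_def)
    then have "beta_density a b x * beta_density a b x powr s = beta_density a b x powr (1 + s)"
      by (simp add: powr_mult_base)
    also have "\<dots> = ((1 - x) powr a * (1 + x) powr b / Z) powr (1 + s)"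
      using True by (simp add: beta_density_def beta_weight_inside Z_def)
    also have "\<dots> = Z powr (-(1 + s)) * ((1 - x) powr (a * (1 + s)) * (1 + x) powr (b * (1 + s)))"
      unfolding powr_minus[of Z "1 + s"] using True Z_pos
      by (simp add: powr_divide powr_mult powr_powr field_simps)
    finally show ?thesis using True by (simp add: beta_weight_inside)
  next
    case False
    then show ?thesis by (auto simp: beta_density_def beta_weight_outside not_less)
  qed
  ultimately have "integrable lborel (\<lambda>x. beta_density a b x * beta_density a b x powr s)"
    by (simp only:)
  then have "integrable (beta_law a b) (\<lambda>x. beta_density a b x powr s)"
    unfolding beta_law_eq
    using borel_measurable_integrable[OF beta_density_integrable[OF a b]]
    by (subst integrable_density) (auto simp: beta_density_nonneg)
  then show ?thesis
    unfolding distr_gauss_X[symmetric]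
    using borel_measurable_integrable[OF beta_density_integrable[OF a b]]
    by (subst (asm) integrable_distr_eq) auto
qed

end

text \<open>\<gamma>^(1-s) is a constant multiple of the centred normal density with variance
  1/(1-s).\<close>

lemma integrable_std_normal_density_power:
  assumes s: "s < 1"
  shows "integrable gauss (\<lambda>t. std_normal_density t powr (- s))"
proof -
  have "std_normal_density t * std_normal_density t powr (- s) =
      ((sqrt (2 * pi)) powr (-(1 - s)) * sqrt (2 * pi * (1 / sqrt (1 - s))\<^sup>2)) *
        normal_density 0 (1 / sqrt (1 - s)) t"
    for t
  proof -
    have "std_normal_density t * std_normal_density t powr (- s) = std_normal_density t powr (1 - s)"
      using powr_mult_base[of "std_normal_density t" "- s"] by (simp add: normal_density_nonneg)
    also have "\<dots> = (1 / sqrt (2 * pi)) powr (1 - s) * exp (- t\<^sup>2 / 2) powr (1 - s)"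
      unfolding std_normal_density_def by (subst powr_mult) auto
    also have "exp (- t\<^sup>2 / 2) powr (1 - s) = exp (- (1 - s) * t\<^sup>2 / 2)"
      by (simp add: powr_def) (simp add: algebra_simps)
    also have "(1 / sqrt (2 * pi)) powr (1 - s) = (sqrt (2 * pi)) powr (-(1 - s))"
      unfolding powr_minus[of "sqrt (2 * pi)" "1 - s"] by (simp add: powr_divide inverse_eq_divide)
    also have "exp (- (1 - s) * t\<^sup>2 / 2) =
        sqrt (2 * pi * (1 / sqrt (1 - s))\<^sup>2) * normal_density 0 (1 / sqrt (1 - s)) t"
      using s by (simp add: normal_density_def power_divide field_simps)
    finally show ?thesis by simp
  qed
  moreover have "integrable lborel (normal_density 0 (1 / sqrt (1 - s)))"
    using s by (intro integrable_normal_density) simp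
  ultimately have "integrable lborel (\<lambda>t. std_normal_density t * std_normal_density t powr (- s))"
    by simp
  then show ?thesis by (subst integrable_density) auto
qed

lemma exists_small_exponent:
  fixes a b :: real
  assumes "a > -1" "b > -1"
  obtains s where "0 < s" "s < 1" "a * (1 + s) > -1" "b * (1 + s) > -1"
proof -
  \<comment> \<open>c (1 + s) > -1 holds once |c| s < c + 1, and r c satisfies this strictly also
    for c = 0, thanks to the 1 in the denominator. The minimum with 1/2 secures s < 1.\<close>
  define r where "r = (\<lambda>c::real. (c + 1) / (1 + \<bar>c\<bar>))"
  define s where "s = min (1/2) (min (r a) (r b))"
  have r: "r c > 0" "\<bar>c\<bar> * r c < c + 1" if "c > -1" for c
    using that by (auto simp: r_def field_simps)
  have s: "0 < s" "s < 1" "s \<le> r a" "s \<le> r b"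
    using r(1)[OF assms(1)] r(1)[OF assms(2)] by (auto simp: s_def)
  have "c * (1 + s) > -1" if c: "c > -1" "s \<le> r c" for c
  proof -
    have "- (c * s) \<le> \<bar>c\<bar> * s" using s(1) abs_ge_minus_self[of "c * s"] by (simp add: abs_mult)
    also have "\<dots> \<le> \<bar>c\<bar> * r c" using c by (intro mult_left_mono) auto
    also have "\<dots> < c + 1" by (rule r(2)[OF c(1)])
    finally show ?thesis by (simp add: algebra_simps)
  qed
  then show thesis using s assms by (intro that[of s]) auto
qed

text \<open>The intermediate value theorem on [-1,1] gives a solution for each t separately. The
  endpoints are excluded because there the Beta distribution function is 0 or 1, values which the
  Gaussian one never attains.\<close>

lemma beta_quantile_exists:
  assumes a: "a > -1" and b: "b > -1"
  obtains X where "beta_transport a b X"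
proof -
  have "\<exists>x\<in>{-1<..<1}. cdf (beta_law a b) x = cdf gauss t" for t
  proof -
    have "\<exists>x. -1 \<le> x \<and> x \<le> 1 \<and> cdf (beta_law a b) x = cdf gauss t"
      using cdf_gauss_bounds[of t] isCont_cdf_beta_law[OF a b] cdf_beta_law_boundary[OF a b]
      by (intro IVT) auto
    then obtain x where x: "-1 \<le> x" "x \<le> 1" "cdf (beta_law a b) x = cdf gauss t" by blast
    then have "x \<noteq> -1" "x \<noteq> 1" using cdf_gauss_bounds[of t] cdf_beta_law_boundary[OF a b] by auto
    then show ?thesis using x by force
  qed
  then obtain X where "\<And>t. X t \<in> {-1<..<1}" "\<And>t. cdf (beta_law a b) (X t) = cdf gauss t" by metis
  then have "beta_transport a b X" using a b by (simp add: beta_transport_def)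
  then show thesis by (rule that)
qed

context beta_transport begin

text \<open>
  Since \<open>X' = \<gamma> / \<rho>(X)\<close>, the inequality \<open>uv \<le> u\<^sup>2 + v\<^sup>2\<close> reduces negative moments of \<open>X'\<close> to a moment of
  \<open>\<rho>(X)\<close>, which depends only on the law of \<open>X\<close>, and to one of \<open>1/\<gamma>\<close>.
\<close>
lemma neg_moment_finite:
  assumes s: "0 < s" "s < 1" "a * (1 + s) > -1" "b * (1 + s) > -1"
  shows "neg_moment (s / 4) (\<lambda>y. (deriv X (y 0))\<^sup>2) < \<infinity>"
proof -
  let ?g = "\<lambda>t. ((deriv X t)\<^sup>2) powr (- (s / 4))"
  let ?\<rho> = "\<lambda>t. beta_density a b (X t)"
  have pos: "deriv X t > 0" for t
    using beta_density_X_pos[of t] by (simp add: deriv_X normal_density_pos)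
  have rm: "beta_density a b \<in> borel_measurable borel"
    using borel_measurable_integrable[OF beta_density_integrable[OF a b]] by simp
  have gm: "?g \<in> borel_measurable borel"
    unfolding deriv_X using rm by measurable
  have bound: "?g t \<le> ?\<rho> t powr s + std_normal_density t powr (- s)" for t
  proof -
    have n: "std_normal_density t > 0" by (simp add: normal_density_pos)
    let ?u = "?\<rho> t powr (s / 2)" and ?v = "std_normal_density t powr (- (s / 2))"
    \<comment> \<open>The exponent s/4 is halved twice on purpose: the square in \<Gamma> = X'^2
      gives s/2, and the squares from uv \<le> u^2 + v^2 give s, the exponent in the two
      integrability lemmas.\<close>
    have "?g t = deriv X t powr (- (s / 2))"
      using pos[of t] by (simp add: powr_powr flip: powr_numeral)
    also have "\<dots> = ?u * ?v"
      using n beta_density_X_pos[of t] by (simp add: deriv_X powr_divide powr_minus field_simps)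
    also have "\<dots> \<le> ?u\<^sup>2 + ?v\<^sup>2" using abs_mult_le_weighted_squares[of 1 ?u ?v] by simp
    also have "?u\<^sup>2 = ?\<rho> t powr s" using beta_density_X_pos[of t] by (simp add: powr_powr flip: powr_numeral)
    also have "?v\<^sup>2 = std_normal_density t powr (- s)" using n by (simp add: powr_powr flip: powr_numeral)
    finally show ?thesis .
  qed
  have "integrable gauss (\<lambda>t. ?\<rho> t powr s + std_normal_density t powr (- s))"
    by (intro Bochner_Integration.integrable_add integrable_beta_density_power
        integrable_std_normal_density_power s)
  then have "integrable gauss ?g"
    using gm bound by (elim Bochner_Integration.integrable_bound) auto
  then have i: "integrable wiener (\<lambda>y. ?g (y 0))"
    using integrable_coordinate[OF gm] by simp
  \<comment> \<open>X' is positive everywhere, so the infinite branch of \<open>neg_moment\<close>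
    never occurs.\<close>
  have "neg_moment (s / 4) (\<lambda>y. (deriv X (y 0))\<^sup>2) = (\<integral>\<^sup>+y. ennreal (?g (y 0)) \<partial>wiener)"
    unfolding neg_moment_def using pos by (intro nn_integral_cong) (simp add: less_imp_neq[symmetric])
  also have "\<dots> = ennreal (\<integral>y. ?g (y 0) \<partial>wiener)"
    by (intro nn_integral_eq_integral i) auto
  finally show ?thesis by simp
qed

lemma distr_wiener_X: "distr wiener borel (\<lambda>y. X (y 0)) = beta_law a b"
proof -
  have "distr wiener borel (\<lambda>y. X (y 0)) = distr (distr wiener borel (\<lambda>y. y 0)) borel X"
    by (subst distr_distr) (auto simp: comp_def)
  then show ?thesis by (simp add: distr_coordinate distr_gauss_X)
qed

end

theorem theorem3p2:
  fixes a b :: real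
  assumes "a > -1" and "b > -1"
  shows "beta_law a b \<in> law_class"
proof -
  obtain X where "beta_transport a b X" using assms by (rule beta_quantile_exists)
  then interpret beta_transport a b X .
  obtain s where s: "0 < s" "s < 1" "a * (1 + s) > -1" "b * (1 + s) > -1"
    using assms by (rule exists_small_exponent)
  have "\<exists>\<theta>>0. \<exists>G. carre_du_champ (\<lambda>y. X (y 0)) (\<lambda>y. X (y 0)) G \<and> neg_moment \<theta> G < \<infinity>"
    using s(1) carre_du_champ_coordinate_0[OF X_mem] neg_moment_finite[OF s]
    by (intro exI[of _ "s / 4"] conjI exI[of _ "\<lambda>y. (deriv X (y 0))\<^sup>2"]) auto
  then show ?thesis
    unfolding law_class_def
    by (intro CollectI exI[of _ "\<lambda>y. X (y 0)"] conjI distr_wiener_X[symmetric] D_infty_coordinate_0[OF X_mem])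
qed

end
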